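(* Let $\mathcal{A}$ be a continuous inverse algebra over $\mathbb{C}$, $n\ge1$, and $[\delta]:=[(p_1,\dots,p_n)]\in\mathrm{Fl}_{\mathcal{A}}(n)$. Then the corresponding flag manifold $\mathrm{Fl}_{\mathcal{A}}([\delta])$ has a structure of smooth manifold modeled on a locally convex space such that the transitive action $\beta^{(n)}|_{\mathcal{A}^\times\times\mathrm{Fl}_{\mathcal{A}}([\delta])}\colon\mathcal{A}^\times\times\mathrm{Fl}_{\mathcal{A}}([\delta])\to\mathrm{Fl}_{\mathcal{A}}([\delta])$ is smooth, and the corresponding orbit mapping $\mathcal{A}^\times\to\mathrm{Fl}_{\mathcal{A}}([\delta])$, $g\mapsto\beta^{(n)}(g,[\delta])$, is smooth and open. Moreover, the injective map $\mathrm{Fl}_{\mathcal{A}}(n)\hookrightarrow\mathrm{Gr}(\mathcal{A})^n$, $[(q_1,\dots,q_n)]\mapsto(q_1\mathcal{A},\dots,q_n\mathcal{A})$, is continuous.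
   Context: A continuous inverse algebra (CIA) is a Hausdorff locally convex unital associative complex algebra $\mathcal{A}$ (with, as usual, jointly continuous multiplication) whose group of units $\mathcal{A}^\times$ is open and for which the inversion $\mathcal{A}^\times\to\mathcal{A}$, $a\mapsto a^{-1}$, is continuous. Smoothness of maps between open subsets of locally convex spaces is in the usual sense of infinite-dimensional Lie theory (all iterated directional derivatives exist and are jointly continuous), manifolds modeled on locally convex spaces are defined accordingly, and $\mathcal{A}^\times$ is a locally convex Lie group as an open subset of $\mathcal{A}$. Let $\mathcal{P}(\mathcal{A})$ be the set of idempotents of $\mathcal{A}$, with the topology induced from $\mathcal{A}$. For $p,q\in\mathcal{P}(\mathcal{A})$ write $p\le q$ if $qp=p$ (i.e. $p\mathcal{A}\subseteq q\mathcal{A}$), and $p\sim q$ if $pq=q$ and $qp=p$ (i.e. $p\mathcal{A}=q\mathcal{A}$). The Grassmannian is $\mathrm{Gr}(\mathcal{A})=\mathcal{P}(\mathcal{A})/\sim$ with the quotient topology; the class of $p$ is identified with the right ideal $p\mathcal{A}$, and $\mathrm{Gr}(\mathcal{A})^n$ carries the product topology. For $n\ge1$ let $\mathcal{P}_n(\mathcal{A})=\{(p_1,\dots,p_n)\in\mathcal{P}(\mathcal{A})^n\mid p_1\le\cdots\le p_n\}$ and let $\mathrm{Fl}_{\mathcal{A}}(n)=\mathcal{P}_n(\mathcal{A})/\sim$ be the set of $n$-flags, where $(p_1,\dots,p_n)\sim(q_1,\dots,q_n)$ iff $p_j\sim q_j$ for all $j$; the class of $(p_1,\dots,p_n)$ is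 denoted $[(p_1,\dots,p_n)]$. The action $\beta^{(n)}\colon\mathcal{A}^\times\times\mathrm{Fl}_{\mathcal{A}}(n)\to\mathrm{Fl}_{\mathcal{A}}(n)$ is left multiplication on tuples of right ideals: $\beta^{(n)}(g,[(p_1,\dots,p_n)])=[(gp_1g^{-1},\dots,gp_ng^{-1})]$, corresponding to $(gp_1\mathcal{A},\dots,gp_n\mathcal{A})$. For $X\in\mathrm{Fl}_{\mathcal{A}}(n)$ the flag manifold $\mathrm{Fl}_{\mathcal{A}}(X)$ is the $\mathcal{A}^\times$-orbit of $X$. The set $\mathrm{Fl}_{\mathcal{A}}(n)$ is the disjoint union of these orbits, and is topologized by the manifold structures on the orbits (so that each orbit is open). *)

theory Defs
  imports "HOL-Analysis.Analysis"
begin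

section \<open>Locally convex spaces\<close>

text \<open>
  Locally convex spaces are structures on a carrier rather than types, because the model space of
  a manifold is existentially quantified.  The carrier is the underlying set of the topology.
  Smoothness is meant over the reals, so scalars are real; a complex locally
  convex space is used through its underlying real one.
\<close>

record 'e lcs =
  vtop :: "'e topology"
  vzero :: 'e
  vadd :: "'e \<Rightarrow> 'e \<Rightarrow> 'e"
  vscale :: "real \<Rightarrow> 'e \<Rightarrow> 'e"

abbreviation vcarrier :: "'e lcs \<Rightarrow> 'e set"
  where "vcarrier E \<equiv> topspace (vtop E)"

locale locally_convex_space =
  fixes E :: "'e lcs"
  assumes zero_closed: "vzero E \<in> vcarrier E"
    and add_closed: "\<lbrakk>x \<in> vcarrier E; y \<in> vcarrier E\<rbrakk> \<Longrightarrow> vadd E x y \<in> vcarrier E"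
    and scale_closed: "x \<in> vcarrier E \<Longrightarrow> vscale E t x \<in> vcarrier E"
    and add_assoc: "\<lbrakk>x \<in> vcarrier E; y \<in> vcarrier E; z \<in> vcarrier E\<rbrakk>
      \<Longrightarrow> vadd E (vadd E x y) z = vadd E x (vadd E y z)"
    and add_commute: "\<lbrakk>x \<in> vcarrier E; y \<in> vcarrier E\<rbrakk> \<Longrightarrow> vadd E x y = vadd E y x"
    and add_zero: "x \<in> vcarrier E \<Longrightarrow> vadd E x (vzero E) = x"
    and add_inverse: "x \<in> vcarrier E \<Longrightarrow> \<exists>y\<in>vcarrier E. vadd E x y = vzero E"
    and scale_add_right: "\<lbrakk>x \<in> vcarrier E; y \<in> vcarrier E\<rbrakk>
      \<Longrightarrow> vscale E t (vadd E x y) = vadd E (vscale E t x) (vscale E t y)"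
    and scale_add_left: "x \<in> vcarrier E
      \<Longrightarrow> vscale E (s + t) x = vadd E (vscale E s x) (vscale E t x)"
    and scale_scale: "x \<in> vcarrier E \<Longrightarrow> vscale E s (vscale E t x) = vscale E (s * t) x"
    and scale_one: "x \<in> vcarrier E \<Longrightarrow> vscale E 1 x = x"
    and hausdorff: "Hausdorff_space (vtop E)"
    and continuous_add:
      "continuous_map (prod_topology (vtop E) (vtop E)) (vtop E) (\<lambda>(x, y). vadd E x y)"
    and continuous_scale:
      "continuous_map (prod_topology euclideanreal (vtop E)) (vtop E) (\<lambda>(t, x). vscale E t x)"
    and locally_convex: "\<lbrakk>openin (vtop E) W; vzero E \<in> W\<rbrakk>
      \<Longrightarrow> \<exists>C. openin (vtop E) C \<and> vzero E \<in> C \<and> C \<subseteq> W \<and>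
        (\<forall>x\<in>C. \<forall>y\<in>C. \<forall>t\<in>{0..1}. vadd E (vscale E (1 - t) x) (vscale E t y) \<in> C)"

definition prod_lcs :: "'e lcs \<Rightarrow> 'f lcs \<Rightarrow> ('e \<times> 'f) lcs" where
  "prod_lcs E F =
    \<lparr>vtop = prod_topology (vtop E) (vtop F),
     vzero = (vzero E, vzero F),
     vadd = (\<lambda>(x, y) (x', y'). (vadd E x x', vadd F y y')),
     vscale = (\<lambda>t (x, y). (vscale E t x, vscale F t y))\<rparr>"


section \<open>Smooth maps between open subsets of locally convex spaces\<close>

text \<open>\<open>y\<close> is the derivative of \<open>f\<close> at \<open>x\<close> in the direction \<open>v\<close>.\<close>

definition has_dir_deriv ::
    "'e lcs \<Rightarrow> 'f lcs \<Rightarrow> ('e \<Rightarrow> 'f) \<Rightarrow> 'e \<Rightarrow> 'e \<Rightarrow> 'f \<Rightarrow> bool" where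
  "has_dir_deriv E F f x v y \<longleftrightarrow>
    limitin (vtop F)
      (\<lambda>t. vscale F (1 / t) (vadd F (f (vadd E x (vscale E t v))) (vscale F (- 1) (f x))))
      y (at (0::real))"

text \<open>
  \<open>D k x v\<close> is the iterated directional derivative of order \<open>k\<close> of \<open>f\<close> at \<open>x\<close> in the directions
  \<open>v 0, \<dots>, v (k - 1)\<close>: differentiating \<open>D k _ (v 0, \<dots>, v (k - 1))\<close> in the direction \<open>v k\<close> gives
  \<open>D (k + 1)\<close>.  Limits being unique, \<open>D\<close> is determined by \<open>f\<close> on \<open>U \<times> E\<^sup>k\<close>.  Outside \<open>U\<close> the
  values of \<open>f\<close> are irrelevant, as \<open>U\<close> is open.
\<close>

definition smooth_on :: "'e lcs \<Rightarrow> 'f lcs \<Rightarrow> 'e set \<Rightarrow> ('e \<Rightarrow> 'f) \<Rightarrow> bool" where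
  "smooth_on E F U f \<longleftrightarrow> openin (vtop E) U \<and>
    (\<exists>D :: nat \<Rightarrow> 'e \<Rightarrow> (nat \<Rightarrow> 'e) \<Rightarrow> 'f.
      (\<forall>x\<in>U. \<forall>v \<in> {..<0} \<rightarrow>\<^sub>E vcarrier E. D 0 x v = f x) \<and>
      (\<forall>k. \<forall>x\<in>U. \<forall>v \<in> {..<Suc k} \<rightarrow>\<^sub>E vcarrier E.
        has_dir_deriv E F (\<lambda>y. D k y (restrict v {..<k})) x (v k) (D (Suc k) x v)) \<and>
      (\<forall>k. continuous_map
        (prod_topology (subtopology (vtop E) U) (product_topology (\<lambda>_. vtop E) {..<k}))
        (vtop F) (\<lambda>(x, v). D k x v)))"


section \<open>Smooth manifolds modeled on locally convex spaces\<close>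

text \<open>A smooth structure is given by an atlas, not necessarily a maximal one.\<close>

record ('m, 'e) manifold =
  model :: "'e lcs"
  mtop :: "'m topology"
  charts :: "('m set \<times> ('m \<Rightarrow> 'e)) set"

locale smooth_manifold =
  fixes M :: "('m, 'e) manifold"
  assumes model_lcs: "locally_convex_space (model M)"
    and hausdorff: "Hausdorff_space (mtop M)"
    and charts_open: "(U, \<phi>) \<in> charts M \<Longrightarrow> openin (mtop M) U \<and> openin (vtop (model M)) (\<phi> ` U)"
    and charts_homeomorphic: "(U, \<phi>) \<in> charts M
      \<Longrightarrow> homeomorphic_map (subtopology (mtop M) U) (subtopology (vtop (model M)) (\<phi> ` U)) \<phi>"
    and charts_cover: "(\<Union>(U, \<phi>)\<in>charts M. U) = topspace (mtop M)"
    and charts_compatible: "\<lbrakk>(U, \<phi>) \<in> charts M; (V, \<psi>) \<in> charts M\<rbrakk>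
      \<Longrightarrow> smooth_on (model M) (model M) (\<phi> ` (U \<inter> V)) (\<psi> \<circ> inv_into U \<phi>)"

definition prod_manifold ::
    "('m, 'e) manifold \<Rightarrow> ('n, 'f) manifold \<Rightarrow> ('m \<times> 'n, 'e \<times> 'f) manifold" where
  "prod_manifold M N =
    \<lparr>model = prod_lcs (model M) (model N),
     mtop = prod_topology (mtop M) (mtop N),
     charts = {(U \<times> V, \<lambda>(x, y). (\<phi> x, \<psi> y)) | U \<phi> V \<psi>.
       (U, \<phi>) \<in> charts M \<and> (V, \<psi>) \<in> charts N}\<rparr>"

definition smooth_map :: "('m, 'e) manifold \<Rightarrow> ('n, 'f) manifold \<Rightarrow> ('m \<Rightarrow> 'n) \<Rightarrow> bool" where
  "smooth_map M N f \<longleftrightarrow> continuous_map (mtop M) (mtop N) f \<and>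
    (\<forall>(U, \<phi>)\<in>charts M. \<forall>(V, \<psi>)\<in>charts N.
      smooth_on (model M) (model N) (\<phi> ` {x \<in> U. f x \<in> V}) (\<psi> \<circ> f \<circ> inv_into U \<phi>))"


section \<open>Continuous inverse algebras\<close>

definition unit_group :: "'a::monoid_mult set" where
  "unit_group = {a. \<exists>b. a * b = 1 \<and> b * a = 1}"

definition unit_inv :: "'a::monoid_mult \<Rightarrow> 'a" where
  "unit_inv a = (THE b. a * b = 1 \<and> b * a = 1)"

definition real_lcs ::
    "(complex \<Rightarrow> 'a \<Rightarrow> 'a) \<Rightarrow> 'a::{topological_space, ab_group_add} lcs" where
  "real_lcs cscale =
    \<lparr>vtop = euclidean, vzero = 0, vadd = (+), vscale = (\<lambda>t. cscale (complex_of_real t))\<rparr>"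

text \<open>
  The class constraints supply the unital ring structure (not excluding \<open>1 = 0\<close>), the Hausdorff
  property, and the joint continuity of addition and multiplication.
\<close>

locale continuous_inverse_algebra = vector_space cscale
  for cscale :: "complex \<Rightarrow> 'a \<Rightarrow>
    'a::{ring, monoid_mult, t2_space, topological_ab_group_add, topological_monoid_mult}" +
  assumes scale_mult_left: "cscale c x * y = cscale c (x * y)"
    and scale_mult_right: "x * cscale c y = cscale c (x * y)"
    and continuous_scale: "continuous_on UNIV (\<lambda>(c, x). cscale c x)"
    and locally_convex: "\<lbrakk>open W; 0 \<in> W\<rbrakk>
      \<Longrightarrow> \<exists>C. open C \<and> 0 \<in> C \<and> C \<subseteq> W \<and>
        (\<forall>x\<in>C. \<forall>y\<in>C. \<forall>t\<in>{0..1::real}.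
          cscale (complex_of_real (1 - t)) x + cscale (complex_of_real t) y \<in> C)"
    and open_unit_group: "open (unit_group :: 'a set)"
    and continuous_unit_inv: "continuous_on unit_group (unit_inv :: 'a \<Rightarrow> 'a)"
begin

lemma locally_convex_space_real_lcs: "locally_convex_space (real_lcs cscale)"
proof
  show "\<exists>y\<in>vcarrier (real_lcs cscale). vadd (real_lcs cscale) x y = vzero (real_lcs cscale)" for x
    by (rule bexI[of _ "- x"]) (simp_all add: real_lcs_def)
  show "continuous_map (prod_topology (vtop (real_lcs cscale)) (vtop (real_lcs cscale)))
      (vtop (real_lcs cscale)) (\<lambda>(x, y). vadd (real_lcs cscale) x y)"
    by (auto simp: real_lcs_def euclidean_product_topology case_prod_unfold intro!: continuous_intros)
  show "Hausdorff_space (vtop (real_lcs cscale))"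
    by (simp add: real_lcs_def Hausdorff_space_def disjnt_def) (metis separation_t2)
  have "continuous_on UNIV (\<lambda>p::real \<times> 'a. cscale (complex_of_real (fst p)) (snd p))"
    using continuous_on_compose2[OF continuous_scale,
        of UNIV "\<lambda>p::real \<times> 'a. (complex_of_real (fst p), snd p)"]
    by (simp add: continuous_on_Pair continuous_on_of_real continuous_on_fst continuous_on_snd
        continuous_on_id)
  then show "continuous_map (prod_topology euclideanreal (vtop (real_lcs cscale)))
      (vtop (real_lcs cscale)) (\<lambda>(t, x). vscale (real_lcs cscale) t x)"
    by (simp add: real_lcs_def euclidean_product_topology case_prod_unfold)
  show "\<exists>C. openin (vtop (real_lcs cscale)) C \<and> vzero (real_lcs cscale) \<in> C \<and> C \<subseteq> W \<and>
      (\<forall>x\<in>C. \<forall>y\<in>C. \<forall>t\<in>{0..1}.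
        vadd (real_lcs cscale) (vscale (real_lcs cscale) (1 - t) x)
          (vscale (real_lcs cscale) t y) \<in> C)"
    if "openin (vtop (real_lcs cscale)) W" "vzero (real_lcs cscale) \<in> W" for W
    using locally_convex[of W] that by (simp add: real_lcs_def)
qed (simp_all add: real_lcs_def add.assoc add.commute scale_right_distrib scale_left_distrib)

end

text \<open>\<open>\<A>\<^sup>\<times>\<close> as a manifold: the open subset of units with the inclusion as its only chart.\<close>

definition unit_manifold ::
    "(complex \<Rightarrow> 'a \<Rightarrow> 'a) \<Rightarrow> ('a::{ring, monoid_mult, topological_space}, 'a) manifold" where
  "unit_manifold cscale =
    \<lparr>model = real_lcs cscale, mtop = top_of_set unit_group, charts = {(unit_group, \<lambda>x. x)}\<rparr>"


section \<open>Grassmannian and flags\<close>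

definition idempotents :: "'a::monoid_mult set" where
  "idempotents = {p. p * p = p}"

definition idem_le :: "'a::monoid_mult \<Rightarrow> 'a \<Rightarrow> bool" where
  "idem_le p q \<longleftrightarrow> q * p = p"

definition idem_sim :: "'a::monoid_mult \<Rightarrow> 'a \<Rightarrow> bool" where
  "idem_sim p q \<longleftrightarrow> p * q = q \<and> q * p = p"

definition gr_rel :: "('a::monoid_mult \<times> 'a) set" where
  "gr_rel = {(p, q). p \<in> idempotents \<and> q \<in> idempotents \<and> idem_sim p q}"

definition grassmannian :: "'a::monoid_mult set set" where
  "grassmannian = idempotents // gr_rel"

definition gr_class :: "'a::monoid_mult \<Rightarrow> 'a set" where
  "gr_class p = gr_rel `` {p}"

definition gr_topology :: "'a::{monoid_mult, topological_space} set topology" where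
  "gr_topology = topology (\<lambda>W. W \<subseteq> grassmannian \<and>
    openin (top_of_set idempotents) {p \<in> idempotents. gr_class p \<in> W})"

text \<open>
  An \<open>n\<close>-tuple is a function on \<open>{1..n}\<close>, taken to be undefined elsewhere.
\<close>

definition idem_chains :: "nat \<Rightarrow> (nat \<Rightarrow> 'a::monoid_mult) set" where
  "idem_chains n =
    {p \<in> {1..n} \<rightarrow>\<^sub>E idempotents. \<forall>j\<in>{1..<n}. idem_le (p j) (p (Suc j))}"

definition flag_rel :: "nat \<Rightarrow> ((nat \<Rightarrow> 'a::monoid_mult) \<times> (nat \<Rightarrow> 'a)) set" where
  "flag_rel n =
    {(p, q). p \<in> idem_chains n \<and> q \<in> idem_chains n \<and> (\<forall>j\<in>{1..n}. idem_sim (p j) (q j))}"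

definition flags :: "nat \<Rightarrow> (nat \<Rightarrow> 'a::monoid_mult) set set" where
  "flags n = idem_chains n // flag_rel n"

definition flag_class :: "nat \<Rightarrow> (nat \<Rightarrow> 'a::monoid_mult) \<Rightarrow> (nat \<Rightarrow> 'a) set" where
  "flag_class n p = flag_rel n `` {p}"

text \<open>
  Maps out of quotients are unions over representatives; the lemmas below show that they
  do not depend on the representative.
\<close>

definition flag_act ::
    "nat \<Rightarrow> 'a \<Rightarrow> (nat \<Rightarrow> 'a) set \<Rightarrow> (nat \<Rightarrow> 'a::monoid_mult) set" where
  "flag_act n g X = (\<Union>p\<in>X. flag_class n (\<lambda>j\<in>{1..n}. g * p j * unit_inv g))"

definition flag_to_gr :: "nat \<Rightarrow> (nat \<Rightarrow> 'a::monoid_mult) set \<Rightarrow> nat \<Rightarrow> 'a set" where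
  "flag_to_gr n X = (\<lambda>j\<in>{1..n}. \<Union>p\<in>X. gr_class (p j))"

definition flag_orbit :: "nat \<Rightarrow> (nat \<Rightarrow> 'a::monoid_mult) set \<Rightarrow> (nat \<Rightarrow> 'a) set set" where
  "flag_orbit n X = (\<lambda>g. flag_act n g X) ` unit_group"

definition flag_orbits :: "nat \<Rightarrow> (nat \<Rightarrow> 'a::monoid_mult) set set set" where
  "flag_orbits n = flag_orbit n ` flags n"

text \<open>Topological sum of topologies \<open>T O\<close> on the orbits \<open>O\<close>.\<close>

definition flag_topology ::
    "nat \<Rightarrow> ((nat \<Rightarrow> 'a::monoid_mult) set set \<Rightarrow> (nat \<Rightarrow> 'a) set topology)
      \<Rightarrow> (nat \<Rightarrow> 'a) set topology" where
  "flag_topology n T =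
    topology (\<lambda>W. W \<subseteq> flags n \<and> (\<forall>Y\<in>flag_orbits n. openin (T Y) (W \<inter> Y)))"

definition transitive_unit_action :: "('a::monoid_mult \<Rightarrow> 'x \<Rightarrow> 'x) \<Rightarrow> 'x set \<Rightarrow> bool" where
  "transitive_unit_action \<beta> S \<longleftrightarrow>
    (\<forall>g\<in>unit_group. \<forall>Y\<in>S. \<beta> g Y \<in> S) \<and>
    (\<forall>Y\<in>S. \<beta> 1 Y = Y) \<and>
    (\<forall>g\<in>unit_group. \<forall>h\<in>unit_group. \<forall>Y\<in>S. \<beta> (g * h) Y = \<beta> g (\<beta> h Y)) \<and>
    S \<noteq> {} \<and> (\<forall>Y\<in>S. \<forall>Z\<in>S. \<exists>g\<in>unit_group. \<beta> g Y = Z)"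

definition flag_manifold_structure ::
    "(complex \<Rightarrow> 'a \<Rightarrow> 'a) \<Rightarrow> nat \<Rightarrow> (nat \<Rightarrow> 'a) set
      \<Rightarrow> ((nat \<Rightarrow> 'a::{ring, monoid_mult, topological_space}) set, 'e) manifold \<Rightarrow> bool" where
  "flag_manifold_structure cscale n X M \<longleftrightarrow>
    smooth_manifold M \<and>
    topspace (mtop M) = flag_orbit n X \<and>
    smooth_map (prod_manifold (unit_manifold cscale) M) M (\<lambda>(g, Y). flag_act n g Y) \<and>
    smooth_map (unit_manifold cscale) M (\<lambda>g. flag_act n g X) \<and>
    open_map (mtop (unit_manifold cscale)) (mtop M) (\<lambda>g. flag_act n g X)"


subsection \<open>Well-definedness\<close>

lemma unit_inv:
  assumes "g \<in> unit_group"
  shows "g * unit_inv g = 1" "unit_inv g * g = 1"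
proof -
  obtain b where b: "g * b = 1" "b * g = 1"
    using assms by (auto simp: unit_group_def)
  have uniq: "c = b" if "g * c = 1 \<and> c * g = 1" for c
    by (metis b(2) mult.assoc mult_1_left mult_1_right that)
  have "unit_inv g = b"
    unfolding unit_inv_def by (rule the_equality) (use b uniq in blast)+
  with b show "g * unit_inv g = 1" "unit_inv g * g = 1" by simp_all
qed

lemma idem_sim_trans: "idem_sim p q \<Longrightarrow> idem_sim q r \<Longrightarrow> idem_sim p r"
  for p q r :: "'a::monoid_mult"
proof -
  assume "idem_sim p q" "idem_sim q r"
  then have *: "p * q = q" "q * p = p" "q * r = r" "r * q = q"
    by (auto simp: idem_sim_def)
  have "p * r = (p * q) * r" by (simp only: mult.assoc *(3))
  moreover have "r * p = (r * q) * p" by (simp only: mult.assoc *(2))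
  ultimately have "p * r = r" "r * p = p" by (simp_all only: *)
  then show "idem_sim p r" by (simp add: idem_sim_def)
qed

lemma idem_sim_iff_right_ideal:
  fixes p q :: "'a::monoid_mult"
  assumes "p \<in> idempotents" "q \<in> idempotents"
  shows "idem_sim p q \<longleftrightarrow> range ((*) p) = range ((*) q)"
proof
  assume "idem_sim p q"
  then show "range ((*) p) = range ((*) q)"
    unfolding idem_sim_def by (auto simp: image_iff) (metis mult.assoc)+
next
  assume eq: "range ((*) p) = range ((*) q)"
  obtain a b where "p = q * a" "q = p * b"
    using eq by (metis mult_1_right rangeE rangeI)
  with assms show "idem_sim p q"
    unfolding idem_sim_def idempotents_def by (metis (mono_tags) mem_Collect_eq mult.assoc)
qed

lemma idem_le_iff_right_ideal:
  fixes p q :: "'a::monoid_mult"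
  assumes "q \<in> idempotents"
  shows "idem_le p q \<longleftrightarrow> range ((*) p) \<subseteq> range ((*) q)"
proof
  assume "idem_le p q"
  then show "range ((*) p) \<subseteq> range ((*) q)"
    unfolding idem_le_def by (auto simp: image_iff) (metis mult.assoc)
next
  assume "range ((*) p) \<subseteq> range ((*) q)"
  then obtain a where "p = q * a"
    by (metis mult_1_right rangeE rangeI subsetD)
  with assms show "idem_le p q"
    unfolding idem_le_def idempotents_def by (metis (mono_tags) mem_Collect_eq mult.assoc)
qed

lemma equiv_gr_rel: "equiv idempotents gr_rel"
proof (rule equivI)
  show "refl_on idempotents gr_rel"
    by (auto simp: refl_on_def gr_rel_def idem_sim_def idempotents_def)
  show "sym gr_rel"
    by (auto simp: sym_def gr_rel_def idem_sim_def)
  show "trans gr_rel"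
    by (auto simp: trans_def gr_rel_def intro: idem_sim_trans)
qed (auto simp: gr_rel_def)

lemma equiv_flag_rel: "equiv (idem_chains n) (flag_rel n)"
proof (rule equivI)
  show "refl_on (idem_chains n) (flag_rel n)"
    by (auto simp: refl_on_def flag_rel_def idem_chains_def idem_sim_def idempotents_def)
  show "sym (flag_rel n)"
    by (auto simp: sym_def flag_rel_def idem_sim_def)
  show "trans (flag_rel n)"
    by (auto simp: trans_def flag_rel_def intro: idem_sim_trans)
qed (auto simp: flag_rel_def)

lemma openin_gr_topology:
  fixes W :: "'a::{monoid_mult, topological_space} set set"
  shows "openin gr_topology W \<longleftrightarrow> W \<subseteq> grassmannian \<and>
    openin (top_of_set idempotents) {p \<in> idempotents. gr_class p \<in> W}"
proof -
  let ?L = "\<lambda>W :: 'a set set. W \<subseteq> grassmannian \<and>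
    openin (top_of_set idempotents) {p \<in> idempotents. gr_class p \<in> W}"
  have top: "istopology ?L"
    unfolding istopology_def
  proof (intro conjI allI impI)
    fix S T :: "'a set set" assume "?L S" "?L T"
    moreover have "{p \<in> idempotents. gr_class p \<in> S \<inter> T} =
        {p \<in> idempotents. gr_class p \<in> S} \<inter> {p \<in> idempotents. gr_class p \<in> T}" by auto
    ultimately show "S \<inter> T \<subseteq> grassmannian"
      "openin (top_of_set idempotents) {p \<in> idempotents. gr_class p \<in> S \<inter> T}"
      by (auto simp only: intro: openin_Int)
  next
    fix K :: "'a set set set" assume K: "\<forall>S\<in>K. ?L S"
    then show "\<Union>K \<subseteq> grassmannian" by auto
    have "{p \<in> idempotents. gr_class p \<in> \<Union>K} =
        (\<Union>S\<in>K. {p \<in> idempotents. gr_class p \<in> S})" by auto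
    moreover have "openin (top_of_set idempotents)
        (\<Union>S\<in>K. {p \<in> idempotents. gr_class p \<in> S})"
      using K by (intro openin_Union) auto
    ultimately show "openin (top_of_set idempotents) {p \<in> idempotents. gr_class p \<in> \<Union>K}"
      by (simp only:)
  qed
  show ?thesis
    unfolding gr_topology_def topology_inverse'[OF top] ..
qed

lemma quotient_map_gr_class:
  "quotient_map (top_of_set (idempotents :: 'a::{monoid_mult, topological_space} set))
    gr_topology gr_class"
proof -
  have "openin (gr_topology :: 'a set topology) grassmannian"
  proof -
    have "{p \<in> idempotents. gr_class p \<in> grassmannian} = (idempotents :: 'a set)"
      by (auto simp: grassmannian_def gr_class_def quotientI)
    then show ?thesis
      by (simp add: openin_gr_topology)
  qed
  then have top: "topspace (gr_topology :: 'a set topology) = grassmannian"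
    by (metis openin_gr_topology openin_subset openin_topspace subset_antisym)
  have "gr_class ` idempotents = (grassmannian :: 'a set set)"
    by (auto simp: grassmannian_def gr_class_def quotient_def)
  then show ?thesis
    by (auto simp: quotient_map_def top openin_gr_topology)
qed

lemma openin_flag_topology:
  fixes W :: "(nat \<Rightarrow> 'a::monoid_mult) set set"
  shows "openin (flag_topology n T) W \<longleftrightarrow>
    W \<subseteq> flags n \<and> (\<forall>Y\<in>flag_orbits n. openin (T Y) (W \<inter> Y))"
proof -
  have "istopology (\<lambda>W :: (nat \<Rightarrow> 'a) set set. W \<subseteq> flags n \<and> (\<forall>Y\<in>flag_orbits n. openin (T Y) (W \<inter> Y)))"
    unfolding istopology_def
  proof (intro conjI allI impI ballI)
    fix A B Y :: "(nat \<Rightarrow> 'a) set set"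
    assume "A \<subseteq> flags n \<and> (\<forall>Y\<in>flag_orbits n. openin (T Y) (A \<inter> Y))"
      "B \<subseteq> flags n \<and> (\<forall>Y\<in>flag_orbits n. openin (T Y) (B \<inter> Y))" "Y \<in> flag_orbits n"
    moreover have "A \<inter> B \<inter> Y = (A \<inter> Y) \<inter> (B \<inter> Y)" by auto
    ultimately show "openin (T Y) (A \<inter> B \<inter> Y)" by (simp add: openin_Int)
  next
    fix K and Y :: "(nat \<Rightarrow> 'a) set set"
    assume "\<forall>W\<in>K. W \<subseteq> flags n \<and> (\<forall>Y\<in>flag_orbits n. openin (T Y) (W \<inter> Y))"
      "Y \<in> flag_orbits n"
    moreover have "\<Union>K \<inter> Y = (\<Union>W\<in>K. W \<inter> Y)" by auto
    ultimately show "openin (T Y) (\<Union>K \<inter> Y)" by (metis (no_types, lifting) openin_Union imageE)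
  qed auto
  then show ?thesis
    by (simp add: flag_topology_def topology_inverse')
qed

lemma conj_mult_conj:
  assumes "g \<in> unit_group"
  shows "(g * p * unit_inv g) * (g * q * unit_inv g) = g * (p * q) * unit_inv g"
proof -
  have "(g * p * unit_inv g) * (g * q * unit_inv g) = g * p * (unit_inv g * g) * q * unit_inv g"
    by (simp only: mult.assoc)
  then show ?thesis
    using unit_inv[OF assms] by (simp add: mult.assoc)
qed

lemma flag_rel_conj:
  assumes g: "g \<in> unit_group" and "(p, q) \<in> flag_rel n"
  shows "(\<lambda>j\<in>{1..n}. g * p j * unit_inv g, \<lambda>j\<in>{1..n}. g * q j * unit_inv g) \<in> flag_rel n"
  using assms(2)
  by (auto simp: flag_rel_def idem_chains_def idem_le_def idem_sim_def idempotents_def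
      conj_mult_conj[OF g] PiE_iff)

lemma flag_act_flag_class:
  assumes g: "g \<in> unit_group" and p: "p \<in> idem_chains n"
  shows "flag_act n g (flag_class n p) = flag_class n (\<lambda>j\<in>{1..n}. g * p j * unit_inv g)"
proof -
  have "flag_class n (\<lambda>j\<in>{1..n}. g * q j * unit_inv g) =
      flag_class n (\<lambda>j\<in>{1..n}. g * p j * unit_inv g)" if "q \<in> flag_class n p" for q
    using that equiv_class_eq[OF equiv_flag_rel flag_rel_conj[OF g, of p q]]
    by (simp add: flag_class_def)
  moreover have "p \<in> flag_class n p"
    unfolding flag_class_def by (rule equiv_class_self[OF equiv_flag_rel p])
  ultimately show ?thesis
    unfolding flag_act_def by blast
qed

lemma flag_to_gr_flag_class:
  assumes p: "p \<in> idem_chains n"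
  shows "flag_to_gr n (flag_class n p) = (\<lambda>j\<in>{1..n}. gr_class (p j))"
proof -
  have "gr_class (q j) = gr_class (p j)" if "q \<in> flag_class n p" "j \<in> {1..n}" for q j
    unfolding gr_class_def
    by (rule equiv_class_eq[OF equiv_gr_rel])
      (use that in \<open>auto simp: flag_class_def flag_rel_def gr_rel_def idem_chains_def
        idem_sim_def PiE_iff\<close>)
  moreover have "p \<in> flag_class n p"
    unfolding flag_class_def by (rule equiv_class_self[OF equiv_flag_rel p])
  ultimately show ?thesis
    unfolding flag_to_gr_def by (intro restrict_ext) blast
qed

end

theory Submission
  imports Defs
begin

text \<open>
  Replacing \<open>p j\<close> by \<open>p j * p (j + 1) * \<dots> * p n\<close> does not change the flag and makes the idempotents
  commute.  They then give a block decomposition of the algebra, and the elements \<open>g\<close> whose leading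
  block minors are invertible (the big cell, an open set containing \<open>1\<close>) have a unique factorization
  \<open>g = u * b\<close> with \<open>b\<close> in the stabilizer of the flag and \<open>u - 1\<close> in the closed subspace \<open>N\<close> of strictly
  lower block triangular elements.  If \<open>r j\<close> denotes the idempotent with range \<open>g * p j * \<A>\<close> and kernel
  \<open>(1 - p j) * \<A>\<close>, then \<open>u\<close> is the sum of the \<open>r (j + 1) * (p (j + 1) - p j)\<close>
  for \<open>0 \<le> j \<le> n\<close>, with \<open>p 0 = 0\<close> and \<open>p (n + 1) = r (n + 1) = 1\<close>.

  The orbit gets the quotient topology of the orbit map, which makes that map open, and the charts
  \<open>a * X \<mapsto> u (g\<^sup>-\<^sup>1 * a) - 1\<close> onto \<open>N\<close>.  In these charts all maps in question are noncommutative
  rational expressions, hence smooth.  The map to the Grassmannians is continuous because its composition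
  with each orbit map is, and orbit maps are open.
\<close>

section \<open>Units\<close>

lemma unit_inv_eqI:
  fixes a b :: "'a::monoid_mult"
  assumes "a * b = 1" "b * a = 1"
  shows unit_groupI: "a \<in> unit_group" and "unit_inv a = b"
proof -
  show u: "a \<in> unit_group"
    using assms by (auto simp: unit_group_def)
  show "unit_inv a = b"
    by (metis assms(2) mult.assoc mult_1_left mult_1_right unit_inv(1)[OF u])
qed

lemma unit_inv_cancel:
  fixes a b :: "'a::monoid_mult"
  assumes "a \<in> unit_group"
  shows "a * (unit_inv a * b) = b" "unit_inv a * (a * b) = b"
  by (simp_all add: mult.assoc[symmetric] unit_inv[OF assms])

lemma unit_group_one: "(1::'a::monoid_mult) \<in> unit_group" and unit_inv_one: "unit_inv 1 = (1::'a::monoid_mult)"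
  using unit_inv_eqI[of "1::'a" 1] by simp_all

lemma unit_group_inv:
  fixes a :: "'a::monoid_mult"
  assumes "a \<in> unit_group"
  shows "unit_inv a \<in> unit_group" and unit_inv_inv: "unit_inv (unit_inv a) = a"
  using unit_inv_eqI[of "unit_inv a" a] unit_inv[OF assms] by simp_all

lemma unit_group_mult:
  fixes a b :: "'a::monoid_mult"
  assumes "a \<in> unit_group" "b \<in> unit_group"
  shows "a * b \<in> unit_group" and unit_inv_mult: "unit_inv (a * b) = unit_inv b * unit_inv a"
proof -
  have "a * b * (unit_inv b * unit_inv a) = 1" "unit_inv b * unit_inv a * (a * b) = 1"
    using assms by (simp_all add: mult.assoc unit_inv_cancel unit_inv)
  then show "a * b \<in> unit_group" "unit_inv (a * b) = unit_inv b * unit_inv a"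
    using unit_inv_eqI by blast+
qed

section \<open>Smoothness of noncommutative rational maps\<close>

text \<open>Only the topology, and with it the carrier, is cut down to \<open>S\<close>. Taking
  \<open>UNIV\<close> gives the algebra back, so results about subspaces also cover the model of the
  unit group.\<close>

definition subspace_lcs ::
    "(complex \<Rightarrow> 'a \<Rightarrow> 'a) \<Rightarrow> 'a set \<Rightarrow> 'a::{topological_space, ab_group_add} lcs" where
  "subspace_lcs cscale S = (real_lcs cscale)\<lparr>vtop := top_of_set S\<rparr>"

lemma subspace_lcs_simps [simp]:
  "vtop (subspace_lcs cscale S) = top_of_set S"
  "vzero (subspace_lcs cscale S) = 0"
  "vadd (subspace_lcs cscale S) = (+)"
  "vscale (subspace_lcs cscale S) = (\<lambda>t. cscale (complex_of_real t))"
  by (simp_all add: subspace_lcs_def real_lcs_def)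

lemma subspace_lcs_UNIV: "subspace_lcs cscale UNIV = real_lcs cscale"
  by (simp add: subspace_lcs_def real_lcs_def)

lemma prod_lcs_simps [simp]:
  "vtop (prod_lcs E F) = prod_topology (vtop E) (vtop F)"
  "vadd (prod_lcs E F) (x, y) (x', y') = (vadd E x x', vadd F y y')"
  "vscale (prod_lcs E F) t (x, y) = (vscale E t x, vscale F t y)"
  by (simp_all add: prod_lcs_def)

text \<open>All that is needed of the vector space structure of the source of a rational map.\<close>

definition lines_continuous :: "'g lcs \<Rightarrow> bool" where
  "lines_continuous G \<longleftrightarrow> (\<forall>x\<in>vcarrier G. \<forall>v\<in>vcarrier G.
    limitin (vtop G) (\<lambda>t. vadd G x (vscale G t v)) x (at (0::real)))"

lemma lines_continuous_prod:
  assumes "lines_continuous E" "lines_continuous F"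
  shows "lines_continuous (prod_lcs E F)"
  using assms by (auto simp: lines_continuous_def limitin_pairwise o_def)

context continuous_inverse_algebra
begin

section \<open>Real subspaces of the algebra as locally convex spaces\<close>

definition real_subspace :: "'a set \<Rightarrow> bool" where
  "real_subspace S \<longleftrightarrow> 0 \<in> S \<and> (\<forall>x\<in>S. \<forall>y\<in>S. x + y \<in> S) \<and>
    (\<forall>t. \<forall>x\<in>S. cscale (complex_of_real t) x \<in> S)"

lemma real_subspace_UNIV: "real_subspace UNIV"
  by (simp add: real_subspace_def)

lemma scale_minus_one: "cscale (- 1) x = - x"
  by (simp add: scale_minus_left)

lemma tendsto_cscale:
  assumes "(c \<longlongrightarrow> c0) F" "(f \<longlongrightarrow> x0) F"
  shows "((\<lambda>t. cscale (c t) (f t)) \<longlongrightarrow> cscale c0 x0) F"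
proof -
  have "isCont (\<lambda>(c, x). cscale c x) (c0, x0)"
    using continuous_scale by (simp add: continuous_on_eq_continuous_at)
  from isCont_tendsto_compose[OF this tendsto_Pair[OF assms]] show ?thesis by simp
qed

lemma tendsto_unit_inv:
  fixes a :: 'a
  assumes "(f \<longlongrightarrow> a) F" "a \<in> unit_group"
  shows "((\<lambda>t. unit_inv (f t)) \<longlongrightarrow> unit_inv a) F"
proof -
  have "isCont (unit_inv :: 'a \<Rightarrow> 'a) a"
    using continuous_unit_inv open_unit_group assms(2)
    by (simp add: continuous_on_eq_continuous_at)
  from isCont_tendsto_compose[OF this assms(1)] show ?thesis .
qed

lemma lines_continuous_subspace:
  assumes "real_subspace S"
  shows "lines_continuous (subspace_lcs cscale S)"
  unfolding lines_continuous_def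
proof (intro ballI)
  fix x v assume "x \<in> vcarrier (subspace_lcs cscale S)" "v \<in> vcarrier (subspace_lcs cscale S)"
  then have S: "x \<in> S" "v \<in> S" by simp_all
  have "((\<lambda>t. x + cscale (complex_of_real t) v) \<longlongrightarrow> x + cscale (complex_of_real 0) v) (at 0)"
    by (intro tendsto_intros tendsto_cscale)
  with S assms show "limitin (vtop (subspace_lcs cscale S))
      (\<lambda>t. vadd (subspace_lcs cscale S) x (vscale (subspace_lcs cscale S) t v)) x (at 0)"
    by (simp add: limitin_subtopology real_subspace_def)
qed

lemma locally_convex_space_subspace:
  assumes S: "real_subspace S"
  shows "locally_convex_space (subspace_lcs cscale S)"
proof -
  interpret A: locally_convex_space "real_lcs cscale"
    by (rule locally_convex_space_real_lcs)
  have S0: "0 \<in> S" and Sadd: "\<And>x y. x \<in> S \<Longrightarrow> y \<in> S \<Longrightarrow> x + y \<in> S"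
    and Sscale: "\<And>t x. x \<in> S \<Longrightarrow> cscale (complex_of_real t) x \<in> S"
    using S by (auto simp: real_subspace_def)
  let ?E = "subspace_lcs cscale S"
  show ?thesis
  proof
    show "\<exists>y\<in>vcarrier ?E. vadd ?E x y = vzero ?E" if "x \<in> vcarrier ?E" for x
      using Sscale[of x "-1"] that by (intro bexI[of _ "- x"]) (simp_all add: scale_minus_one)
    show "Hausdorff_space (vtop ?E)"
      using Hausdorff_space_subtopology[OF A.hausdorff, of S] by (simp add: real_lcs_def)
    show "continuous_map (prod_topology (vtop ?E) (vtop ?E)) (vtop ?E) (\<lambda>(x, y). vadd ?E x y)"
      using A.continuous_add Sadd
      by (auto simp: real_lcs_def continuous_map_in_subtopology subtopology_Times[symmetric]
          intro: continuous_on_subset)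
    have "prod_topology euclideanreal (top_of_set S) =
        subtopology (prod_topology euclideanreal euclidean) (UNIV \<times> S)"
      by (metis subtopology_Times subtopology_UNIV)
    then show "continuous_map (prod_topology euclideanreal (vtop ?E)) (vtop ?E)
        (\<lambda>(t, x). vscale ?E t x)"
      using A.continuous_scale Sscale
      by (auto simp: real_lcs_def continuous_map_in_subtopology
          intro: continuous_on_subset)
    show "\<exists>C. openin (vtop ?E) C \<and> vzero ?E \<in> C \<and> C \<subseteq> W \<and>
        (\<forall>x\<in>C. \<forall>y\<in>C. \<forall>t\<in>{0..1}. vadd ?E (vscale ?E (1 - t) x) (vscale ?E t y) \<in> C)"
      if W: "openin (vtop ?E) W" "vzero ?E \<in> W" for W
    proof -
      \<comment> \<open>Convex neighbourhoods in the subspace are traces on \<open>S\<close> of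
        convex ones in the algebra.\<close>
      obtain V where V: "open V" "W = S \<inter> V" using W(1) by (auto simp: openin_open)
      with W(2) obtain C where C: "open C" "0 \<in> C" "C \<subseteq> V"
        "\<forall>x\<in>C. \<forall>y\<in>C. \<forall>t\<in>{0..1}. cscale (complex_of_real (1 - t)) x + cscale (complex_of_real t) y \<in> C"
        using locally_convex[of V] by auto
      have "cscale (1 - complex_of_real t) x \<in> S" if "x \<in> S" for t x
        using Sscale[OF that, of "1 - t"] by simp
      with C V S0 Sadd Sscale show ?thesis
        by (intro exI[of _ "S \<inter> C"]) auto
    qed
  qed (use S0 Sadd Sscale in \<open>simp_all add: add.assoc add.commute scale_right_distrib
      scale_left_distrib\<close>)
qed

section \<open>Rational expressions and their joint continuity\<close>

definition linear_to_algebra :: "'g lcs \<Rightarrow> ('g \<Rightarrow> 'a) \<Rightarrow> bool" where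
  "linear_to_algebra G l \<longleftrightarrow> continuous_map (vtop G) euclidean l \<and>
    (\<forall>x\<in>vcarrier G. \<forall>v\<in>vcarrier G. \<forall>t.
      l (vadd G x (vscale G t v)) = l x + cscale (complex_of_real t) (l v))"

text \<open>
  Noncommutative rational expressions in a point \<open>x\<close> and directions \<open>v 0, \<dots>, v (k - 1)\<close>.  Explicit
  formulas keep this class closed under directional derivatives, so smoothness needs
  neither a chain rule nor a mean value theorem in locally convex spaces.
\<close>

inductive rational :: "'g lcs \<Rightarrow> 'g set \<Rightarrow> nat \<Rightarrow> ('g \<Rightarrow> (nat \<Rightarrow> 'g) \<Rightarrow> 'a) \<Rightarrow> bool"
  for G U where
  const: "rational G U k (\<lambda>x v. c)"
| linear: "linear_to_algebra G l \<Longrightarrow> rational G U k (\<lambda>x v. l x)"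
| direction: "linear_to_algebra G l \<Longrightarrow> i < k \<Longrightarrow> rational G U k (\<lambda>x v. l (v i))"
| add: "rational G U k f \<Longrightarrow> rational G U k g \<Longrightarrow> rational G U k (\<lambda>x v. f x v + g x v)"
| mult: "rational G U k f \<Longrightarrow> rational G U k g \<Longrightarrow> rational G U k (\<lambda>x v. f x v * g x v)"
| inverse: "rational G U k f \<Longrightarrow>
    (\<And>x v. x \<in> U \<Longrightarrow> v \<in> {..<k} \<rightarrow>\<^sub>E vcarrier G \<Longrightarrow> f x v \<in> unit_group) \<Longrightarrow>
    rational G U k (\<lambda>x v. unit_inv (f x v))"

lemma rational_uminus:
  assumes "rational G U k f"
  shows "rational G U k (\<lambda>x v. - f x v)"
  using rational.mult[OF rational.const[of G U k "- 1"] assms] by simp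

text \<open>Differentiation adds a direction, while the undifferentiated factors of a product depend
  only on the old ones. Restriction feeds those factors the first \<open>k\<close>
  directions.\<close>

lemma rational_restrict:
  assumes "rational G U k f"
  shows "rational G U (Suc k) (\<lambda>x v. f x (restrict v {..<k}))"
  using assms
proof induction
  case (direction l i k)
  then show ?case using rational.direction[of G l i "Suc k" U] by simp
next
  case (inverse k f)
  have "restrict v {..<k} \<in> {..<k} \<rightarrow>\<^sub>E vcarrier G"
    if "v \<in> {..<Suc k} \<rightarrow>\<^sub>E vcarrier G" for v
    using that by (auto simp: PiE_iff)
  with inverse.hyps(2) have "f x (restrict v {..<k}) \<in> unit_group"
    if "x \<in> U" "v \<in> {..<Suc k} \<rightarrow>\<^sub>E vcarrier G" for x v
    using that by blast
  with inverse.IH show ?case by (rule rational.inverse)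
qed (rule rational.const rational.linear rational.add rational.mult; assumption)+

text \<open>Every constructor preserves limits, the inverse by continuity of inversion on the open
  unit group. The limit is joint in the point and the directions because \<open>smooth_on\<close>
  asks for joint continuity.\<close>

lemma tendsto_rational:
  assumes "rational G U k f" "x \<in> U" "v \<in> {..<k} \<rightarrow>\<^sub>E vcarrier G" "U \<subseteq> vcarrier G"
  shows "limitin euclidean (\<lambda>(x, v). f x v) (f x v)
    (atin (prod_topology (subtopology (vtop G) U) (product_topology (\<lambda>_. vtop G) {..<k})) (x, v))"
  (is "limitin _ _ _ (?at k)")
proof -
  have "((\<lambda>z. f (fst z) (snd z)) \<longlongrightarrow> f x v) (?at k)"
    using assms
  proof induction
    case (linear l k)
    then have "continuous_map (prod_topology (subtopology (vtop G) U)
        (product_topology (\<lambda>_. vtop G) {..<k})) euclidean (l \<circ> fst)"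
      unfolding linear_to_algebra_def
      by (metis (no_types, lifting) continuous_map_compose continuous_map_fst
          continuous_map_from_subtopology continuous_map_into_fulltopology)
    from limitin_continuous_map[OF this, of "(x, v)"] linear show ?case
      by (auto simp: o_def PiE_iff)
  next
    case (direction l i k)
    then have "continuous_map (prod_topology (subtopology (vtop G) U)
        (product_topology (\<lambda>_. vtop G) {..<k})) euclidean (l \<circ> ((\<lambda>v. v i) \<circ> snd))"
      unfolding linear_to_algebra_def
      by (intro continuous_map_compose[OF continuous_map_compose[OF continuous_map_snd]])
        (auto intro: continuous_map_product_projection)
    from limitin_continuous_map[OF this, of "(x, v)"] direction show ?case
      by (auto simp: o_def PiE_iff)
  qed (auto intro: tendsto_intros tendsto_unit_inv)
  then show ?thesis by (simp add: case_prod_unfold)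
qed

lemma continuous_map_rational:
  assumes "rational G U k f" "U \<subseteq> vcarrier G"
  shows "continuous_map
    (prod_topology (subtopology (vtop G) U) (product_topology (\<lambda>_. vtop G) {..<k}))
    euclidean (\<lambda>(x, v). f x v)"
  unfolding continuous_map_atin using tendsto_rational[OF assms(1) _ _ assms(2)] by auto

section \<open>Directional derivatives of rational expressions\<close>

lemma line_eventually_in:
  assumes "lines_continuous G" "openin (vtop G) U" "x \<in> U" "v \<in> vcarrier G"
  shows "\<forall>\<^sub>F t in at (0::real). vadd G x (vscale G t v) \<in> U"
  using assms openin_subset[of "vtop G" U] unfolding lines_continuous_def limitin_def by blast

lemma rational_line_tendsto:
  assumes G: "lines_continuous G" "openin (vtop G) U" and f: "rational G U k f"
    and x: "x \<in> U" and v: "v \<in> vcarrier G" and w: "w \<in> {..<k} \<rightarrow>\<^sub>E vcarrier G"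
  shows "((\<lambda>t. f (vadd G x (vscale G t v)) w) \<longlongrightarrow> f x w) (at (0::real))"
proof -
  have UG: "U \<subseteq> vcarrier G" by (rule openin_subset[OF G(2)])
  have "limitin (subtopology (vtop G) U) (\<lambda>t. vadd G x (vscale G t v)) x (at (0::real))"
    using line_eventually_in[OF G x v] G(1) UG x v
    by (auto simp: limitin_subtopology lines_continuous_def)
  then have "limitin (prod_topology (subtopology (vtop G) U) (product_topology (\<lambda>_. vtop G) {..<k}))
      (\<lambda>t. (vadd G x (vscale G t v), w)) (x, w) (at (0::real))"
    using w by (simp add: limitin_pairwise o_def)
  from continuous_map_limit[OF continuous_map_rational[OF f UG] this]
  show ?thesis by (simp add: o_def)
qed

text \<open>The new direction \<open>w\<close> goes into slot \<open>k\<close>, matching the role of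
  \<open>v k\<close> in \<open>smooth_on\<close>.\<close>

definition derivative_of ::
    "'g lcs \<Rightarrow> 'g set \<Rightarrow> nat \<Rightarrow> ('g \<Rightarrow> (nat \<Rightarrow> 'g) \<Rightarrow> 'a) \<Rightarrow> ('g \<Rightarrow> (nat \<Rightarrow> 'g) \<Rightarrow> 'a) \<Rightarrow> bool" where
  "derivative_of G U k f f' \<longleftrightarrow> (\<forall>x\<in>U. \<forall>v\<in>{..<k} \<rightarrow>\<^sub>E vcarrier G. \<forall>w\<in>vcarrier G.
    ((\<lambda>t. cscale (complex_of_real (1 / t)) (f (vadd G x (vscale G t w)) v - f x v))
      \<longlongrightarrow> f' x (v(k := w))) (at 0))"

lemma derivative_ofD:
  assumes "derivative_of G U k f f'" "x \<in> U" "v \<in> {..<k} \<rightarrow>\<^sub>E vcarrier G" "w \<in> vcarrier G"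
  shows "((\<lambda>t. cscale (complex_of_real (1 / t)) (f (vadd G x (vscale G t w)) v - f x v))
      \<longlongrightarrow> f' x (v(k := w))) (at 0)"
  using assms unfolding derivative_of_def by blast

lemma restrict_upd_PiE:
  assumes "v \<in> {..<k::nat} \<rightarrow>\<^sub>E A"
  shows "restrict (v(k := w)) {..<k} = v"
  using assms by (auto simp: PiE_iff extensional_def fun_eq_iff)

text \<open>Sums, products and inverses obey the usual rules with the order of the factors kept. The
  derivative is rational again, so the lemma can be iterated.\<close>

lemma rational_derivative:
  assumes G: "lines_continuous G" "openin (vtop G) U" and f: "rational G U k f"
  shows "\<exists>f'. rational G U (Suc k) f' \<and> derivative_of G U k f f'"
  using f
proof (induction)
  case (const k c)
  have "derivative_of G U k (\<lambda>x v. c) (\<lambda>x v. 0)" by (simp add: derivative_of_def)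
  with rational.const show ?case by blast
next
  case (direction l i k)
  have "derivative_of G U k (\<lambda>x v. l (v i)) (\<lambda>x v. 0)" by (simp add: derivative_of_def)
  with rational.const show ?case by blast
next
  case (linear l k)
  have UG: "U \<subseteq> vcarrier G" by (rule openin_subset[OF G(2)])
  have "derivative_of G U k (\<lambda>x v. l x) (\<lambda>x v. l (v k))"
    unfolding derivative_of_def
  proof (intro ballI)
    fix x v w assume x: "x \<in> U" and w: "w \<in> vcarrier G"
    \<comment> \<open>Linearity along lines makes the difference quotient constant for
      \<open>t \<noteq> 0\<close>, which is all that the limit sees.\<close>
    have "cscale (complex_of_real (1 / t)) (l (vadd G x (vscale G t w)) - l x) = l w"
      if "t \<noteq> 0" for t
    proof -
      have "l (vadd G x (vscale G t w)) = l x + cscale (complex_of_real t) (l w)"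
        using linear x w UG by (auto simp: linear_to_algebra_def)
      with that show ?thesis by simp
    qed
    then have "\<forall>\<^sub>F t in at 0. cscale (complex_of_real (1 / t)) (l (vadd G x (vscale G t w)) - l x) = l w"
      by (simp add: eventually_at_filter)
    then show "((\<lambda>t. cscale (complex_of_real (1 / t)) (l (vadd G x (vscale G t w)) - l x))
      \<longlongrightarrow> l ((v(k := w)) k)) (at 0)"
      by (simp add: tendsto_eventually)
  qed
  with rational.direction[OF linear, of k "Suc k"] show ?case by blast
next
  case (add k f g)
  then obtain f' g' where f': "rational G U (Suc k) f'" "derivative_of G U k f f'"
    and g': "rational G U (Suc k) g'" "derivative_of G U k g g'" by blast
  have eq: "cscale c (a + b - (a0 + b0)) = cscale c (a - a0) + cscale c (b - b0)" for c a b a0 b0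
    by (simp add: add_diff_add scale_right_distrib)
  have "derivative_of G U k (\<lambda>x v. f x v + g x v) (\<lambda>x v. f' x v + g' x v)"
    unfolding derivative_of_def eq
    by (intro ballI tendsto_add derivative_ofD[OF f'(2)] derivative_ofD[OF g'(2)])
  with rational.add[OF f'(1) g'(1)] show ?case by blast
next
  case (mult k f g)
  then obtain f' g' where f': "rational G U (Suc k) f'" "derivative_of G U k f f'"
    and g': "rational G U (Suc k) g'" "derivative_of G U k g g'" by blast
  \<comment> \<open>In the first summand \<open>b\<close> is the value of \<open>g\<close> at the
    moved point, so its limit comes from continuity of \<open>g\<close> along the line.\<close>
  have eq: "cscale c (a * b - a0 * b0) = cscale c (a - a0) * b + a0 * cscale c (b - b0)"
    for c a b a0 b0
    by (simp add: scale_mult_left scale_mult_right scale_right_diff_distrib algebra_simps)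
  have "derivative_of G U k (\<lambda>x v. f x v * g x v)
    (\<lambda>x v. f' x v * g x (restrict v {..<k}) + f x (restrict v {..<k}) * g' x v)"
    unfolding derivative_of_def eq
    by (intro ballI)
      (simp only: restrict_upd_PiE, intro tendsto_add tendsto_mult tendsto_const
        derivative_ofD[OF f'(2)] derivative_ofD[OF g'(2)]
        rational_line_tendsto[OF G mult.hyps(2)])
  with rational.add[OF rational.mult[OF f'(1) rational_restrict[OF mult.hyps(2)]]
      rational.mult[OF rational_restrict[OF mult.hyps(1)] g'(1)]]
  show ?case by blast
next
  case (inverse k f)
  then obtain f' where f': "rational G U (Suc k) f'" "derivative_of G U k f f'" by blast
  let ?h = "\<lambda>x v. unit_inv (f x v)"
  have h: "rational G U k ?h"
    using inverse.hyps by (rule rational.inverse)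
  \<comment> \<open>The resolvent identity, scaled by \<open>c\<close>.\<close>
  have eq: "cscale c (unit_inv b - unit_inv a) = - (unit_inv b * cscale c (b - a) * unit_inv a)"
    if "a \<in> unit_group" "b \<in> unit_group" for a b c
  proof -
    have "unit_inv b * (b - a) * unit_inv a = unit_inv a - unit_inv b"
      using that by (simp add: algebra_simps unit_inv unit_inv_cancel)
    then show ?thesis
      by (simp add: scale_mult_left scale_mult_right flip: scale_minus_right)
  qed
  have "derivative_of G U k ?h
    (\<lambda>x v. - (?h x (restrict v {..<k}) * f' x v * ?h x (restrict v {..<k})))"
    unfolding derivative_of_def
  proof (intro ballI)
    fix x v w assume x: "x \<in> U" and v: "v \<in> {..<k} \<rightarrow>\<^sub>E vcarrier G" and w: "w \<in> vcarrier G"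
    let ?y = "\<lambda>t. vadd G x (vscale G t w)"
    \<comment> \<open>The moved point is in \<open>U\<close> for all small \<open>t\<close>, and
      membership in \<open>U\<close> is what makes \<open>f\<close> invertible there.\<close>
    have "\<forall>\<^sub>F t in at 0.
        - (?h (?y t) v * cscale (complex_of_real (1 / t)) (f (?y t) v - f x v) * ?h x v)
        = cscale (complex_of_real (1 / t)) (?h (?y t) v - ?h x v)"
      using line_eventually_in[OF G x w] by eventually_elim (simp add: eq inverse.hyps(2) x v)
    moreover have "((\<lambda>t.
        - (?h (?y t) v * cscale (complex_of_real (1 / t)) (f (?y t) v - f x v) * ?h x v))
        \<longlongrightarrow> - (?h x v * f' x (v(k := w)) * ?h x v)) (at 0)"
      by (intro tendsto_minus tendsto_mult tendsto_const rational_line_tendsto[OF G h x w v]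
          derivative_ofD[OF f'(2) x v w])
    ultimately show "((\<lambda>t. cscale (complex_of_real (1 / t)) (?h (?y t) v - ?h x v))
        \<longlongrightarrow> - (?h x (restrict (v(k := w)) {..<k}) * f' x (v(k := w)) *
          ?h x (restrict (v(k := w)) {..<k}))) (at 0)"
      unfolding restrict_upd_PiE[OF v] by (rule Lim_transform_eventually[rotated])
  qed
  moreover have "rational G U (Suc k)
    (\<lambda>x v. - (?h x (restrict v {..<k}) * f' x v * ?h x (restrict v {..<k})))"
    using rational_restrict[OF h] f'(1)
    by (intro rational_uminus rational.mult[where f = "\<lambda>x v. ?h x (restrict v {..<k}) * f' x v"]
        rational.mult[where g = f'])
  ultimately show ?case by blast
qed

section \<open>From rational expressions to smooth maps\<close>

definition rational_on :: "'g lcs \<Rightarrow> 'g set \<Rightarrow> ('g \<Rightarrow> 'a) \<Rightarrow> bool" where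
  "rational_on G U f \<longleftrightarrow> rational G U 0 (\<lambda>x v. f x)"

text \<open>Iterating \<open>rational_derivative\<close> by dependent choice yields the derivatives
  of all orders. They take values in \<open>S\<close> because the difference quotients do and
  \<open>S\<close> is closed.\<close>

lemma smooth_on_rational:
  assumes G: "lines_continuous G" "openin (vtop G) U" and S: "real_subspace S" "closed S"
    and f: "rational_on G U f'" and eq: "\<And>x. x \<in> U \<Longrightarrow> f x = f' x"
    and fS: "\<And>x. x \<in> U \<Longrightarrow> f' x \<in> S"
  shows "smooth_on G (subspace_lcs cscale S) U f"
proof -
  have UG: "U \<subseteq> vcarrier G" by (rule openin_subset[OF G(2)])
  \<comment> \<open>The invariant \<open>P\<close> forces the chosen sequence to start with
    \<open>f'\<close>.\<close>
  define P where "P = (\<lambda>k D. rational G U k D \<and> (k = 0 \<longrightarrow> D = (\<lambda>x v. f' x)))"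
  have "\<exists>D'. P (Suc k) D' \<and> derivative_of G U k D D'" if "P k D" for k D
    using that rational_derivative[OF G, of k D] by (simp add: P_def)
  moreover have "\<exists>D. P 0 D"
    using f by (simp add: P_def rational_on_def)
  ultimately obtain D where D: "\<And>k. P k (D k)" "\<And>k. derivative_of G U k (D k) (D (Suc k))"
    using dependent_nat_choice[of P "derivative_of G U"] by blast
  have rat: "rational G U k (D k)" for k using D(1) by (simp add: P_def)
  have D0: "D 0 = (\<lambda>x v. f' x)" using D(1)[of 0] by (simp add: P_def)
  have S_scale_diff: "cscale (complex_of_real t) (a - b) \<in> S" if "a \<in> S" "b \<in> S" for a b t
  proof -
    have "cscale (complex_of_real (-1)) b \<in> S" using S(1) that by (metis real_subspace_def)
    then have "a + cscale (complex_of_real (-1)) b \<in> S" using S(1) that by (metis real_subspace_def)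
    then show ?thesis using S(1) by (simp add: scale_minus_one real_subspace_def)
  qed
  have split: "restrict v {..<k} \<in> {..<k} \<rightarrow>\<^sub>E vcarrier G" "v k \<in> vcarrier G"
      "(restrict v {..<k})(k := v k) = v"
    if "v \<in> {..<Suc k} \<rightarrow>\<^sub>E vcarrier G" for v k
    using that by (auto simp: PiE_iff extensional_def fun_eq_iff)
  have deriv: "((\<lambda>t. cscale (complex_of_real (1 / t))
      (D k (vadd G x (vscale G t (v k))) (restrict v {..<k}) - D k x (restrict v {..<k})))
      \<longlongrightarrow> D (Suc k) x v) (at 0)"
    if "x \<in> U" "v \<in> {..<Suc k} \<rightarrow>\<^sub>E vcarrier G" for k x v
    using derivative_ofD[OF D(2)[of k] that(1) split(1,2)[OF that(2)]] split(3)[OF that(2)] by simp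
  have quotient_in: "\<forall>\<^sub>F t in at 0. cscale (complex_of_real (1 / t))
      (D k (vadd G x (vscale G t (v k))) (restrict v {..<k}) - D k x (restrict v {..<k})) \<in> S"
    if x: "x \<in> U" and v: "v \<in> {..<Suc k} \<rightarrow>\<^sub>E vcarrier G"
      and DS: "\<forall>x\<in>U. \<forall>v\<in>{..<k} \<rightarrow>\<^sub>E vcarrier G. D k x v \<in> S" for k x v
    using line_eventually_in[OF G x split(2)[OF v]]
    by eventually_elim (use DS x split(1)[OF v] in \<open>blast intro: S_scale_diff\<close>)
  have DS: "\<forall>x\<in>U. \<forall>v\<in>{..<k} \<rightarrow>\<^sub>E vcarrier G. D k x v \<in> S" for k
  proof (induction k)
    case 0
    show ?case by (simp add: D0 fS)
  next
    case (Suc k)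
    show ?case
      by (intro ballI Lim_in_closed_set[OF S(2) quotient_in[OF _ _ Suc] _ deriv]) auto
  qed
  have "has_dir_deriv G (subspace_lcs cscale S) (\<lambda>y. D k y (restrict v {..<k})) x (v k) (D (Suc k) x v)"
    if "x \<in> U" "v \<in> {..<Suc k} \<rightarrow>\<^sub>E vcarrier G" for k x v
    using deriv[OF that] quotient_in[OF that DS] DS[of "Suc k"] that
    by (simp add: has_dir_deriv_def limitin_subtopology scale_minus_one)
  moreover have "continuous_map
        (prod_topology (subtopology (vtop G) U) (product_topology (\<lambda>_. vtop G) {..<k}))
        (vtop (subspace_lcs cscale S)) (\<lambda>(x, v). D k x v)" for k
    using continuous_map_rational[OF rat UG] DS
    by (auto simp: continuous_map_in_subtopology)
  ultimately show ?thesis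
    unfolding smooth_on_def using G(2)
    by (intro conjI exI[of _ D]) (auto simp: D0 eq)
qed

lemma rational_on_const: "rational_on G U (\<lambda>x. c)"
  and rational_on_linear: "linear_to_algebra G l \<Longrightarrow> rational_on G U l"
  and rational_on_add: "rational_on G U f \<Longrightarrow> rational_on G U g \<Longrightarrow> rational_on G U (\<lambda>x. f x + g x)"
  and rational_on_mult: "rational_on G U f \<Longrightarrow> rational_on G U g \<Longrightarrow> rational_on G U (\<lambda>x. f x * g x)"
  and rational_on_unit_inv: "rational_on G U f \<Longrightarrow> (\<And>x. x \<in> U \<Longrightarrow> f x \<in> unit_group) \<Longrightarrow>
    rational_on G U (\<lambda>x. unit_inv (f x))"
  unfolding rational_on_def
  by (rule rational.const rational.linear rational.add rational.mult rational.inverse; simp)+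

lemma rational_on_diff_const:
  assumes "rational_on G U f"
  shows "rational_on G U (\<lambda>x. f x - c)"
  using rational_on_add[OF assms rational_on_const[of _ _ "- c"]] by simp

lemma rational_on_sum:
  assumes "\<And>i. i \<in> I \<Longrightarrow> rational_on G U (f i)"
  shows "rational_on G U (\<lambda>x. \<Sum>i\<in>I. f i x)"
  using assms
  by (induction I rule: infinite_finite_induct) (auto intro: rational_on_const rational_on_add)

lemma linear_subspace_incl:
  "linear_to_algebra (subspace_lcs cscale S) (\<lambda>x. x)"
  by (simp add: linear_to_algebra_def continuous_map_from_subtopology)

lemma linear_to_algebra_prod:
  shows "linear_to_algebra E l \<Longrightarrow> linear_to_algebra (prod_lcs E F) (\<lambda>z. l (fst z))"
    and "linear_to_algebra F m \<Longrightarrow> linear_to_algebra (prod_lcs E F) (\<lambda>z. m (snd z))"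
  unfolding linear_to_algebra_def
  using continuous_map_compose[OF continuous_map_fst[of "vtop E" "vtop F"], of euclidean l]
    continuous_map_compose[OF continuous_map_snd[of "vtop E" "vtop F"], of euclidean m]
  by (auto simp: o_def)

end

section \<open>Block triangular factorization\<close>

text \<open>The geometric sum \<open>s m\<close> is a two-sided inverse.\<close>

lemma one_minus_nilpotent_unit:
  fixes x :: "'a::{ring, monoid_mult}"
  assumes "x ^ m = 0"
  shows "1 - x \<in> unit_group"
proof -
  define s where "s = (\<lambda>k. \<Sum>i<k. x ^ i)"
  have s_Suc: "s (Suc k) = s k + x ^ k" for k by (simp add: s_def)
  have "(1 - x) * s k = 1 - x ^ k" for k
  proof (induction k)
    case (Suc k)
    then show ?case by (simp add: s_Suc distrib_left) (simp add: left_diff_distrib)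
  qed (simp add: s_def)
  moreover have "s k * (1 - x) = 1 - x ^ k" for k
  proof (induction k)
    case (Suc k)
    then show ?case by (simp add: s_Suc distrib_right) (simp add: right_diff_distrib power_commutes)
  qed (simp add: s_def)
  ultimately show ?thesis
    using assms unit_groupI[of "1 - x" "s m"] by simp
qed

lemma mult_mult_eq:
  fixes a b c x :: "'a::monoid_mult"
  assumes "a * b = c"
  shows "a * (b * x) = c * x"
  by (simp add: assms mult.assoc[symmetric])

text \<open>
  A commuting chain \<open>Q 1, \<dots>, Q n\<close>, extended by \<open>Q 0 = 0\<close> and \<open>Q j = 1\<close> for \<open>j > n\<close>.  Then
  \<open>1 = (Q 1 - Q 0) + \<dots> + (Q (n + 1) - Q n)\<close> is a decomposition into orthogonal idempotents.
\<close>

locale nested_idempotents =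
  fixes Q :: "nat \<Rightarrow> 'a::{ring, monoid_mult}" and n :: nat
  assumes Q_0: "Q 0 = 0"
    and Q_top: "n < j \<Longrightarrow> Q j = 1"
    and Q_le: "i \<le> j \<Longrightarrow> Q i * Q j = Q i"
    and Q_ge: "i \<le> j \<Longrightarrow> Q j * Q i = Q i"
begin

lemmas Q_simps = Q_le Q_ge Q_le[THEN mult_mult_eq] Q_ge[THEN mult_mult_eq]

definition block :: "nat \<Rightarrow> 'a" where
  "block j = Q (Suc j) - Q j"

text \<open>In block matrix terms: the strictly lower triangular elements.\<close>

definition lower :: "'a set" where
  "lower = {x. \<forall>j. Q (Suc j) * (x * Q j) = Q (Suc j) * x}"

text \<open>The isotropy group of the flag. Invariance of a right ideal under \<open>b\<close> alone
  would in general give only an inclusion, so the inverse is included as well.\<close>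

definition stabilizer :: "'a set" where
  "stabilizer = {b \<in> unit_group. \<forall>j. Q j * (b * Q j) = b * Q j \<and>
    Q j * (unit_inv b * Q j) = unit_inv b * Q j}"

text \<open>
  \<open>minor j g\<close> is a unit iff \<open>Q j * g * Q j\<close> is one in the corner algebra \<open>Q j * \<A> * Q j\<close>.  In that case
  \<open>projector j g\<close> is the idempotent with range \<open>g * Q j * \<A>\<close> and kernel \<open>(1 - Q j) * \<A>\<close>.
\<close>

definition minor :: "nat \<Rightarrow> 'a \<Rightarrow> 'a" where
  "minor j g = Q j * (g * Q j) + (1 - Q j)"

text \<open>The index \<open>Suc n\<close>, where \<open>Q\<close> is \<open>1\<close>, forces
  \<open>g\<close> itself to be a unit. The finite range of indices is what makes the set
  open.\<close>

definition big_cell :: "'a set" where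
  "big_cell = {g. \<forall>j\<le>Suc n. minor j g \<in> unit_group}"

definition projector :: "nat \<Rightarrow> 'a \<Rightarrow> 'a" where
  "projector j g = g * (Q j * (unit_inv (minor j g) * Q j))"

definition unipotent :: "'a \<Rightarrow> 'a" where
  "unipotent g = (\<Sum>j\<le>n. projector (Suc j) g * block j)"

section \<open>Identities for blocks, minors and projectors\<close>

lemma sum_block: "(\<Sum>j\<le>n. block j) = 1"
  using sum_telescope[of "\<lambda>j. - Q j" n] by (simp add: block_def Q_0 Q_top)

lemma block_mult_Q: "block i * Q j = (if i < j then block i else 0)"
  by (auto simp: block_def algebra_simps Q_simps)

lemma Q_mult_block: "Q j * block i = (if i < j then block i else 0)"
  by (auto simp: block_def algebra_simps Q_simps)

lemma minor_top: "n < j \<Longrightarrow> minor j g = g"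
  by (simp add: minor_def Q_top)

lemma big_cell_unit: "big_cell \<subseteq> unit_group"
  unfolding big_cell_def using minor_top[of "Suc n"] by auto

lemma big_cell_minor: "g \<in> big_cell \<Longrightarrow> minor j g \<in> unit_group"
  unfolding big_cell_def using minor_top[of j g] minor_top[of "Suc n" g]
  by (cases "j \<le> Suc n") (auto simp: not_le)

text \<open>\<open>minor j g\<close> is block diagonal for \<open>Q j\<close> and
  \<open>1 - Q j\<close>, so a factor \<open>Q j\<close> on either side leaves its corner.\<close>

lemma Q_mult_minor: "Q j * minor j g = Q j * (g * Q j)"
  and minor_mult_Q: "minor j g * Q j = Q j * (g * Q j)"
  by (simp_all add: minor_def algebra_simps Q_simps)

text \<open>The first two identities say that \<open>projector j g\<close> has the kernel of
  \<open>Q j\<close>, the third that it fixes the right ideal of \<open>g * Q j\<close>. The first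
  and third proofs trade the corner \<open>Q j * (g * Q j)\<close> for \<open>minor j g\<close>,
  which cancels against its inverse.\<close>

lemma
  assumes "g \<in> big_cell"
  shows Q_projector: "Q j * projector j g = Q j"
    and projector_Q: "projector j g * Q j = projector j g"
    and projector_fixes: "projector j g * (g * Q j) = g * Q j"
proof -
  note m = big_cell_minor[OF assms, of j]
  have "Q j * projector j g = (Q j * (g * Q j)) * (unit_inv (minor j g) * Q j)"
    by (simp add: projector_def mult.assoc)
  also have "\<dots> = Q j * (minor j g * (unit_inv (minor j g) * Q j))"
    by (simp only: Q_mult_minor[symmetric] mult.assoc)
  finally show "Q j * projector j g = Q j"
    by (simp add: unit_inv_cancel[OF m] Q_simps)
  show "projector j g * Q j = projector j g"
    by (simp add: projector_def mult.assoc Q_simps)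
  have "projector j g * (g * Q j) = g * (Q j * (unit_inv (minor j g) * (Q j * (g * Q j))))"
    by (simp add: projector_def mult.assoc)
  also have "\<dots> = g * (Q j * (unit_inv (minor j g) * (minor j g * Q j)))"
    by (simp only: minor_mult_Q)
  finally show "projector j g * (g * Q j) = g * Q j"
    by (simp add: unit_inv_cancel[OF m] Q_simps)
qed

text \<open>The range of \<open>projector i g\<close> lies in the right ideal of
  \<open>g * Q i\<close>, hence in that of \<open>g * Q j\<close>, which
  \<open>projector j g\<close> fixes.\<close>

lemma projector_absorbs:
  assumes "g \<in> big_cell" "i \<le> j"
  shows "projector j g * projector i g = projector i g"
proof -
  have "projector i g = (g * Q j) * (Q i * (unit_inv (minor i g) * Q i))"
    by (simp add: projector_def mult.assoc Q_simps assms(2))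
  then show ?thesis
    by (simp only: mult.assoc[symmetric]) (simp only: mult.assoc projector_fixes[OF assms(1)])
qed

text \<open>The kernels agree, so inclusion of one range in the other gives equality: insert
  \<open>Q j = Q j * projector j h\<close> into \<open>projector j g * Q j\<close>.\<close>

lemma projector_eqI:
  assumes "g \<in> big_cell" "h \<in> big_cell" "projector j g * projector j h = projector j h"
  shows "projector j g = projector j h"
  by (metis assms Q_projector projector_Q mult.assoc)

section \<open>Right invariance under the stabilizer\<close>

lemma minor_mult_stabilizer:
  assumes "Q j * (b * Q j) = b * Q j"
  shows "minor j (a * b) = minor j a * minor j b"
proof -
  have "minor j a * minor j b = Q j * (a * (Q j * (b * Q j))) + (1 - Q j)"
    by (simp add: minor_def algebra_simps Q_simps)
  then show ?thesis
    by (simp add: assms minor_def mult.assoc)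
qed

lemma minor_one: "minor j 1 = 1"
  by (simp add: minor_def Q_simps)

lemma minor_stabilizer_unit:
  assumes "b \<in> stabilizer"
  shows "minor j b \<in> unit_group"
proof (rule unit_groupI)
  show "minor j b * minor j (unit_inv b) = 1" "minor j (unit_inv b) * minor j b = 1"
    using assms by (simp_all add: stabilizer_def unit_inv minor_one flip: minor_mult_stabilizer)
qed

text \<open>This makes the unipotent factor a function on the orbit. The projectors do not change,
  because \<open>g * b * Q j\<close> factors through \<open>g * Q j\<close>.\<close>

lemma
  assumes g: "g \<in> big_cell" and b: "b \<in> stabilizer"
  shows big_cell_mult_stabilizer: "g * b \<in> big_cell"
    and unipotent_mult_stabilizer: "unipotent (g * b) = unipotent g"
proof -
  have bQ: "Q j * (b * Q j) = b * Q j" for j using b by (simp add: stabilizer_def)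
  show gb: "g * b \<in> big_cell"
    using g by (auto simp: big_cell_def minor_mult_stabilizer[OF bQ]
        intro: unit_group_mult minor_stabilizer_unit[OF b])
  have "projector j (g * b) = projector j g" for j
  proof -
    have "projector j (g * b) = (g * Q j) * (b * (Q j * (unit_inv (minor j (g * b)) * Q j)))"
      by (simp add: projector_def mult.assoc) (metis bQ mult.assoc)
    then have "projector j g * projector j (g * b) = projector j (g * b)"
      by (simp only: mult.assoc[symmetric]) (simp only: mult.assoc projector_fixes[OF g])
    then show ?thesis by (rule projector_eqI[OF g gb, symmetric])
  qed
  then show "unipotent (g * b) = unipotent g" by (simp add: unipotent_def)
qed

section \<open>Strictly lower triangular elements and the big cell\<close>

lemma lower_power:
  assumes "x \<in> lower"
  shows "Q j * x ^ j = 0"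
proof (induction j)
  case 0
  show ?case by (simp add: Q_0)
next
  case (Suc j)
  \<comment> \<open>Each factor \<open>x\<close> lowers the index of \<open>Q\<close> by one. At
    \<open>Suc n\<close>, where \<open>Q\<close> is \<open>1\<close>, this gives nilpotency.\<close>
  have "Q (Suc j) * x ^ Suc j = (Q (Suc j) * (x * Q j)) * x ^ j"
    using assms by (simp add: lower_def mult.assoc)
  also have "\<dots> = 0" by (simp add: mult.assoc Suc.IH)
  finally show ?case .
qed

lemma one_plus_lower_unit:
  assumes "x \<in> lower"
  shows "1 + x \<in> unit_group"
proof -
  have "- x \<in> lower" using assms by (simp add: lower_def)
  from lower_power[OF this, of "Suc n"] have "(- x) ^ Suc n = 0" by (simp add: Q_top)
  from one_minus_nilpotent_unit[OF this] show ?thesis by simp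
qed

text \<open>The minors of \<open>1 + x\<close> are \<open>1\<close> plus a corner of
  \<open>x\<close>, and that corner is again strictly lower triangular.\<close>

lemma one_plus_lower_in_big_cell:
  assumes "x \<in> lower"
  shows "1 + x \<in> big_cell"
proof -
  have "Q j * (x * Q j) \<in> lower" for j
    unfolding lower_def
  proof (intro CollectI allI)
    fix i
    have x: "Q (Suc i) * (x * Q i) = Q (Suc i) * x"
      using assms by (simp add: lower_def)
    \<comment> \<open>For \<open>j \<le> i\<close> the right \<open>Q j\<close> absorbs
      \<open>Q i\<close>. For \<open>i < j\<close>, \<open>Q (Suc i)\<close> absorbs the left
      \<open>Q j\<close>, and the right one disappears because \<open>Q (Suc i) * x\<close> already
      ends in \<open>Q i\<close>.\<close>
    show "Q (Suc i) * (Q j * (x * Q j) * Q i) = Q (Suc i) * (Q j * (x * Q j))"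
    proof (cases "j \<le> i")
      case True
      then show ?thesis by (simp add: mult.assoc Q_simps)
    next
      case False
      have "Q (Suc i) * (x * Q j) = (Q (Suc i) * (x * Q i)) * Q j"
        by (simp only: x mult.assoc)
      also have "\<dots> = Q (Suc i) * x"
        using False by (simp add: mult.assoc Q_le) (simp only: x)
      finally show ?thesis
        using False x by (simp add: mult.assoc Q_simps)
    qed
  qed
  moreover have "minor j (1 + x) = 1 + Q j * (x * Q j)" for j
    by (simp add: minor_def algebra_simps Q_simps)
  ultimately show ?thesis
    by (simp add: big_cell_def one_plus_lower_unit)
qed

text \<open>This makes every element of \<open>lower\<close> a chart value. The term
  \<open>x * block j\<close> is killed by \<open>Q (Suc j)\<close>, so
  \<open>projector (Suc j)\<close> recovers \<open>(1 + x) * block j\<close> from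
  \<open>block j\<close>.\<close>

lemma unipotent_one_plus_lower:
  assumes x: "x \<in> lower"
  shows "unipotent (1 + x) = 1 + x"
proof -
  let ?g = "1 + x"
  note g = one_plus_lower_in_big_cell[OF x]
  have "projector (Suc j) ?g * block j = ?g * block j" for j
  proof -
    have "Q (Suc j) * (x * block j) = 0"
    proof -
      have "Q (Suc j) * (x * block j) = Q (Suc j) * (x * Q j) * block j"
        using x by (simp add: lower_def mult.assoc)
      then show ?thesis by (simp add: mult.assoc Q_mult_block)
    qed
    then have "block j = Q (Suc j) * (?g * block j)"
      by (simp add: distrib_left distrib_right Q_mult_block)
    then have "projector (Suc j) ?g * block j = projector (Suc j) ?g * (?g * block j)"
      by (metis projector_Q[OF g] mult.assoc)
    also have "\<dots> = projector (Suc j) ?g * (?g * Q (Suc j)) * block j"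
      by (simp add: mult.assoc Q_mult_block)
    finally show ?thesis
      by (simp add: projector_fixes[OF g] mult.assoc Q_mult_block)
  qed
  then have "unipotent ?g = ?g * (\<Sum>j\<le>n. block j)"
    by (simp add: unipotent_def sum_distrib_left)
  then show ?thesis by (simp add: sum_block)
qed

lemma unipotent_minus_one_lower:
  assumes g: "g \<in> big_cell"
  shows "unipotent g - 1 \<in> lower"
proof -
  have u: "unipotent g - 1 = (\<Sum>i\<le>n. (projector (Suc i) g - 1) * block i)"
    by (simp add: unipotent_def left_diff_distrib sum_subtractf sum_block)
  \<comment> \<open>Blockwise form of membership in \<open>lower\<close>. For \<open>i < j\<close>,
    \<open>Q j\<close> fixes \<open>block i\<close>; otherwise \<open>Q (Suc j)\<close> absorbs
    \<open>Q (Suc i)\<close>, which annihilates \<open>projector (Suc i) g - 1\<close>.\<close>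
  have "Q (Suc j) * ((projector (Suc i) g - 1) * block i * (Q j - 1)) = 0" for i j
  proof (cases "i < j")
    case True
    then show ?thesis by (simp add: mult.assoc right_diff_distrib block_mult_Q)
  next
    case False
    then have "Q (Suc j) * ((projector (Suc i) g - 1) * y)
        = Q (Suc j) * (Q (Suc i) * (projector (Suc i) g - 1) * y)" for y
      by (simp add: mult.assoc Q_simps)
    then show ?thesis
      by (simp add: mult.assoc) (simp add: right_diff_distrib Q_projector[OF g] flip: mult.assoc)
  qed
  then have "Q (Suc j) * ((unipotent g - 1) * (Q j - 1)) = 0" for j
    unfolding u by (simp add: sum_distrib_left sum_distrib_right)
  then show ?thesis
    by (simp add: lower_def right_diff_distrib)
qed

section \<open>Factorization into a unipotent and a stabilizing factor\<close>

lemma stabilizer_projectorI: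
  assumes g: "g \<in> big_cell" and h: "h \<in> big_cell"
    and eq: "\<And>j. projector j g = projector j h"
  shows "unit_inv g * h \<in> stabilizer"
proof -
  \<comment> \<open>Equal projectors put \<open>b * Q j\<close> into the right ideal of
    \<open>a * Q j\<close>; then \<open>a\<close> is divided out.\<close>
  have *: "Q j * (unit_inv a * b * Q j) = unit_inv a * b * Q j"
    if "a \<in> big_cell" "b \<in> big_cell" "projector j a = projector j b" for a b j
  proof -
    have a: "a \<in> unit_group" using that(1) big_cell_unit by blast
    have "unit_inv a * b * Q j = unit_inv a * (projector j a * (b * Q j))"
      using that(3) projector_fixes[OF that(2)] by (simp add: mult.assoc)
    also have "\<dots> = Q j * (unit_inv (minor j a) * (Q j * (b * Q j)))"
      by (simp add: projector_def mult.assoc unit_inv_cancel[OF a])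
    finally have "unit_inv a * b * Q j = Q j * (unit_inv (minor j a) * (Q j * (b * Q j)))" .
    then show ?thesis by (simp add: Q_simps)
  qed
  have "g \<in> unit_group" "h \<in> unit_group" using g h big_cell_unit by auto
  then show ?thesis
    using *[OF g h eq] *[OF h g eq[symmetric]]
    by (simp add: stabilizer_def unit_group_mult unit_group_inv unit_inv_mult unit_inv_inv)
qed

text \<open>\<open>unipotent g\<close> lies in the big cell and has the same projectors as
  \<open>g\<close>.\<close>

lemma unipotent_stabilizer:
  assumes g: "g \<in> big_cell"
  shows "unit_inv g * unipotent g \<in> stabilizer"
proof (rule stabilizer_projectorI[OF g])
  let ?u = "unipotent g"
  show u: "?u \<in> big_cell"
    using one_plus_lower_in_big_cell[OF unipotent_minus_one_lower[OF g]] by simp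
  fix j
  have "projector j g * (?u * Q j) = ?u * Q j"
  proof -
    \<comment> \<open>Only blocks with \<open>i < j\<close> survive the factor \<open>Q j\<close>,
      and for these \<open>projector_absorbs\<close> applies with
      \<open>Suc i \<le> j\<close>.\<close>
    have "projector j g * (projector (Suc i) g * block i * Q j) = projector (Suc i) g * block i * Q j" for i
    proof (cases "i < j")
      case True
      then show ?thesis
        using projector_absorbs[OF g, of "Suc i" j]
        by (simp add: mult.assoc block_mult_Q mult_mult_eq)
    qed (simp add: mult.assoc block_mult_Q)
    then show ?thesis
      by (simp add: unipotent_def sum_distrib_left sum_distrib_right)
  qed
  then have "projector j g * projector j ?u = projector j ?u"
    by (simp add: projector_def[of j ?u]) (metis mult.assoc)
  then show "projector j g = projector j ?u"
    by (rule projector_eqI[OF g u])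
qed

end

section \<open>Quotient topologies\<close>

definition image_topology :: "'x topology \<Rightarrow> ('x \<Rightarrow> 'y) \<Rightarrow> 'y topology" where
  "image_topology X f = topology (\<lambda>W. W \<subseteq> f ` topspace X \<and> openin X {x \<in> topspace X. f x \<in> W})"

lemma openin_image_topology:
  "openin (image_topology X f) W \<longleftrightarrow>
    W \<subseteq> f ` topspace X \<and> openin X {x \<in> topspace X. f x \<in> W}"
proof -
  have "istopology (\<lambda>W. W \<subseteq> f ` topspace X \<and> openin X {x \<in> topspace X. f x \<in> W})"
    unfolding istopology_def
  proof (intro conjI allI impI)
    fix S T assume "S \<subseteq> f ` topspace X \<and> openin X {x \<in> topspace X. f x \<in> S}"
      "T \<subseteq> f ` topspace X \<and> openin X {x \<in> topspace X. f x \<in> T}"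
    moreover have "{x \<in> topspace X. f x \<in> S \<inter> T} =
        {x \<in> topspace X. f x \<in> S} \<inter> {x \<in> topspace X. f x \<in> T}" by auto
    ultimately show "S \<inter> T \<subseteq> f ` topspace X" "openin X {x \<in> topspace X. f x \<in> S \<inter> T}"
      by (auto simp only: intro: openin_Int)
  next
    fix K assume K: "\<forall>S\<in>K. S \<subseteq> f ` topspace X \<and> openin X {x \<in> topspace X. f x \<in> S}"
    then show "\<Union>K \<subseteq> f ` topspace X" by auto
    have "{x \<in> topspace X. f x \<in> \<Union>K} = (\<Union>S\<in>K. {x \<in> topspace X. f x \<in> S})" by auto
    moreover have "openin X (\<Union>S\<in>K. {x \<in> topspace X. f x \<in> S})"
      using K by (intro openin_Union) auto
    ultimately show "openin X {x \<in> topspace X. f x \<in> \<Union>K}" by simp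
  qed
  then show ?thesis by (simp add: image_topology_def topology_inverse')
qed

lemma topspace_image_topology: "topspace (image_topology X f) = f ` topspace X"
proof -
  have "{x \<in> topspace X. f x \<in> f ` topspace X} = topspace X" by auto
  then have "openin (image_topology X f) (f ` topspace X)"
    by (simp add: openin_image_topology)
  then show ?thesis
    by (metis openin_image_topology openin_subset openin_topspace subset_antisym)
qed

lemma quotient_map_image_topology: "quotient_map X (image_topology X f) f"
  by (auto simp: quotient_map_def topspace_image_topology openin_image_topology)

text \<open>Products of quotient maps need not be quotient maps; openness survives the product and
  serves instead when continuity of the action is proved.\<close>

lemma open_map_prod_id:
  assumes "open_map Y Z f"
  shows "open_map (prod_topology X Y) (prod_topology X Z) (\<lambda>(x, y). (x, f y))"
  unfolding open_map_def openin_prod_topology_alt[of X Z]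
proof (intro allI impI)
  fix W x z
  assume W: "openin (prod_topology X Y) W" and "(x, z) \<in> (\<lambda>(x, y). (x, f y)) ` W"
  then obtain y where y: "(x, y) \<in> W" "z = f y" by auto
  then obtain A B where AB: "openin X A" "openin Y B" "x \<in> A" "y \<in> B" "A \<times> B \<subseteq> W"
    using W unfolding openin_prod_topology_alt by meson
  have "openin Z (f ` B)" using assms AB(2) by (simp add: open_map_def)
  moreover have "A \<times> f ` B \<subseteq> (\<lambda>(x, y). (x, f y)) ` W" using AB(5) by force
  ultimately show "\<exists>U V. openin X U \<and> openin Z V \<and> x \<in> U \<and> z \<in> V \<and>
      U \<times> V \<subseteq> (\<lambda>(x, y). (x, f y)) ` W"
    using AB y(2) by blast
qed

section \<open>The action on flags\<close>

lemma conj_idem_chain: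
  assumes "g \<in> unit_group" "p \<in> idem_chains n"
  shows "(\<lambda>j\<in>{1..n}. g * p j * unit_inv g) \<in> idem_chains n"
proof -
  have "(p, p) \<in> flag_rel n"
    using equiv_flag_rel assms(2) by (rule equiv_class_self[THEN ImageE]) auto
  from flag_rel_conj[OF assms(1) this] show ?thesis by (simp add: flag_rel_def)
qed

lemma flagsE:
  assumes "X \<in> flags n"
  obtains p where "p \<in> idem_chains n" "X = flag_class n p"
  using assms by (auto simp: flags_def flag_class_def quotient_def)

lemma flag_class_in_flags: "p \<in> idem_chains n \<Longrightarrow> flag_class n p \<in> flags n"
  by (auto simp: flags_def flag_class_def quotient_def)

lemma flag_class_eq_iff:
  assumes "p \<in> idem_chains n" "q \<in> idem_chains n"
  shows "flag_class n p = flag_class n q \<longleftrightarrow> (\<forall>j\<in>{1..n}. idem_sim (p j) (q j))"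
  using eq_equiv_class_iff[OF equiv_flag_rel assms] assms
  by (simp add: flag_class_def flag_rel_def)

lemma flag_act_in_flags:
  assumes "g \<in> unit_group" "X \<in> flags n"
  shows "flag_act n g X \<in> flags n"
  using assms
  by (auto elim!: flagsE simp: flag_act_flag_class simp del: One_nat_def
      intro!: flag_class_in_flags conj_idem_chain)

lemma flag_act_one:
  assumes "X \<in> flags n"
  shows "flag_act n 1 X = X"
proof -
  obtain p where p: "p \<in> idem_chains n" "X = flag_class n p" using assms by (rule flagsE)
  have "restrict p {1..n} = p" using p(1) by (auto simp: idem_chains_def PiE_restrict)
  then show ?thesis
    using p by (simp add: flag_act_flag_class unit_group_one unit_inv_one)
qed

lemma flag_act_mult:
  assumes g: "g \<in> unit_group" and h: "h \<in> unit_group" and X: "X \<in> flags n"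
  shows "flag_act n (g * h) X = flag_act n g (flag_act n h X)"
proof -
  obtain p where p: "p \<in> idem_chains n" "X = flag_class n p" using X by (rule flagsE)
  have "(\<lambda>j\<in>{1..n}. g * h * p j * unit_inv (g * h)) =
      (\<lambda>j\<in>{1..n}. g * (\<lambda>j\<in>{1..n}. h * p j * unit_inv h) j * unit_inv g)"
    using g h by (intro restrict_ext) (simp add: unit_inv_mult mult.assoc)
  then show ?thesis
    using p g h by (simp add: flag_act_flag_class unit_group_mult conj_idem_chain del: One_nat_def)
qed

lemma flag_orbit_self: "X \<in> flags n \<Longrightarrow> X \<in> flag_orbit n X"
  unfolding flag_orbit_def by (metis flag_act_one image_eqI unit_group_one)

lemma flag_orbit_eq:
  assumes X: "X \<in> flags n" and Y: "Y \<in> flag_orbit n X"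
  shows "flag_orbit n Y = flag_orbit n X"
proof -
  obtain h where h: "h \<in> unit_group" "Y = flag_act n h X" using Y by (auto simp: flag_orbit_def)
  have "flag_act n g Y = flag_act n (g * h) X" if "g \<in> unit_group" for g
    using that h X by (simp add: flag_act_mult)
  moreover have "flag_act n g X = flag_act n (g * unit_inv h) Y" if "g \<in> unit_group" for g
    using that h X by (simp add: mult.assoc unit_inv unit_group_inv unit_group_mult flip: flag_act_mult)
  ultimately show ?thesis
    using h(1) unfolding flag_orbit_def by (auto simp: image_iff) (meson unit_group_mult unit_group_inv)+
qed

lemma transitive_unit_action_flag_orbit:
  assumes X: "X \<in> flags n"
  shows "transitive_unit_action (flag_act n) (flag_orbit n X)"
  unfolding transitive_unit_action_def
proof (intro conjI ballI)
  have flag: "Y \<in> flags n" if "Y \<in> flag_orbit n X" for Y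
    using that X by (auto simp: flag_orbit_def flag_act_in_flags)
  show "flag_orbit n X \<noteq> {}" using flag_orbit_self[OF X] by blast
  fix Y assume Y: "Y \<in> flag_orbit n X"
  show "flag_act n 1 Y = Y" by (rule flag_act_one[OF flag[OF Y]])
  show "flag_act n (g * h) Y = flag_act n g (flag_act n h Y)"
    if "g \<in> unit_group" "h \<in> unit_group" for g h
    by (rule flag_act_mult[OF that flag[OF Y]])
  show "\<exists>g\<in>unit_group. flag_act n g Y = Z" if "Z \<in> flag_orbit n X" for Z
  proof -
    have "Z \<in> flag_orbit n Y" using that flag_orbit_eq[OF X Y] by simp
    then show ?thesis by (auto simp: flag_orbit_def)
  qed
  show "flag_act n g Y \<in> flag_orbit n X" if "g \<in> unit_group" for g
    using that flag_orbit_eq[OF X Y] by (auto simp: flag_orbit_def)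
qed

lemma inj_on_flag_to_gr: "inj_on (flag_to_gr n) (flags n)"
proof (rule inj_onI)
  fix X Y assume "X \<in> flags n" "Y \<in> flags n" and eq: "flag_to_gr n X = flag_to_gr n Y"
  then obtain p q where p: "p \<in> idem_chains n" "X = flag_class n p"
    and q: "q \<in> idem_chains n" "Y = flag_class n q" by (metis flagsE)
  have "idem_sim (p j) (q j)" if j: "j \<in> {1..n}" for j
  proof -
    have "gr_class (p j) = gr_class (q j)"
      using fun_cong[OF eq, of j] p q j by (simp add: flag_to_gr_flag_class)
    moreover have "q j \<in> idempotents" using q(1) j by (auto simp: idem_chains_def)
    ultimately have "(p j, q j) \<in> gr_rel"
      unfolding gr_class_def using equiv_gr_rel by (metis eq_equiv_class)
    then show ?thesis by (simp add: gr_rel_def)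
  qed
  then show "X = Y" using p q by (simp add: flag_class_eq_iff)
qed

lemma (in nested_idempotents) restrict_idem_chain: "restrict Q {1..n} \<in> idem_chains n"
  by (auto simp: idem_chains_def idempotents_def idem_le_def Q_simps)

lemma nested_representative:
  fixes p :: "nat \<Rightarrow> 'a::{ring, monoid_mult}"
  assumes p: "p \<in> idem_chains n"
  shows "\<exists>Q. nested_idempotents Q n \<and> flag_class n (restrict Q {1..n}) = flag_class n p"
proof -
  \<comment> \<open>The entry \<open>0\<close> at index \<open>0\<close> makes \<open>Q 0\<close>
    vanish.\<close>
  define P where "P j = (if j = 0 then 0 else p j)" for j
  \<comment> \<open>\<open>Q j = p j * \<dots> * p n\<close> has the same right ideal as \<open>p j\<close>, because \<open>p k\<close> fixes \<open>p j\<close> for \<open>k \<ge> j\<close>.\<close>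
  define Q where "Q j = prod_list (map P [j..<Suc n])" for j
  have idem: "p j * p j = p j" if "1 \<le> j" "j \<le> n" for j
    using p that by (auto simp: idem_chains_def idempotents_def PiE_iff)
  have P_idem: "P j * P j = P j" if "j \<le> n" for j
    using idem[of j] that by (simp add: P_def)
  have P_le: "P (Suc j) * P j = P j" if "j < n" for j
    using p that by (auto simp: idem_chains_def idem_le_def P_def)
  have Q_top: "Q j = 1" if "n < j" for j
    using that by (simp add: Q_def)
  have Q_rec: "Q j = P j * Q (Suc j)" if "j \<le> n" for j
    using that by (simp add: Q_def upt_conv_Cons del: upt_Suc)
  \<comment> \<open>Descending induction: \<open>Q (Suc j)\<close> fixes \<open>P j\<close> because
    it fixes \<open>P (Suc j)\<close> and \<open>P (Suc j) * P j = P j\<close>. Idempotency of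
    \<open>Q j\<close> then follows from its first factor \<open>P j\<close>.\<close>
  have *: "Q j * P j = P j \<and> Q j * Q j = Q j" if "j \<le> n" for j
    using that
  proof (induction rule: inc_induct)
    case base
    show ?case by (simp add: Q_rec Q_top P_idem)
  next
    case (step j)
    then have IH: "Q (Suc j) * P (Suc j) = P (Suc j)" "Q (Suc j) * Q (Suc j) = Q (Suc j)" by auto
    have "Q (Suc j) * P j = Q (Suc j) * P (Suc j) * P j"
      using P_le[of j] step.hyps by (simp add: mult.assoc)
    then have QP: "Q (Suc j) * P j = P j"
      using P_le[of j] step.hyps IH(1) by simp
    have "Q j * P j = P j"
      using step.hyps by (simp add: Q_rec[of j] mult.assoc QP P_idem)
    then have "Q j * Q j = Q j"
      using step.hyps by (simp add: Q_rec[of j] flip: mult.assoc)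
    with \<open>Q j * P j = P j\<close> show ?case by simp
  qed
  have step: "Q j * Q (Suc j) = Q j \<and> Q (Suc j) * Q j = Q j" for j
  proof (cases "j < n")
    case True
    have "Q (Suc j) * P j = P j"
      using *[of "Suc j"] P_le[of j] True by (metis mult.assoc Suc_leI)
    then show ?thesis
      using *[of "Suc j"] True by (simp add: Q_rec[of j] mult.assoc) (simp flip: mult.assoc)
  qed (simp add: Q_top)
  have idemQ: "Q j * Q j = Q j" for j
    using * Q_top by (cases "j \<le> n") auto
  have "Q i * Q j = Q i \<and> Q j * Q i = Q i" if "i \<le> j" for i j
    using that
  proof (induction rule: dec_induct)
    case (step j)
    then show ?case
      using \<open>\<And>j. Q j * Q (Suc j) = Q j \<and> Q (Suc j) * Q j = Q j\<close> by (metis mult.assoc)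
  qed (simp add: idemQ)
  moreover have "Q 0 = 0" by (simp add: Q_rec P_def)
  ultimately interpret nested_idempotents Q n
    by unfold_locales (auto simp: Q_top)
  have "idem_sim (Q j) (p j)" if "j \<in> {1..n}" for j
  proof -
    have "p j * Q j = Q j"
      using that idem[of j] by (simp add: Q_rec[of j] P_def flip: mult.assoc)
    moreover have "Q j * p j = p j"
      using that *[of j] by (simp add: P_def)
    ultimately show ?thesis by (simp add: idem_sim_def)
  qed
  then have "flag_class n (restrict Q {1..n}) = flag_class n p"
    using p restrict_idem_chain by (simp add: flag_class_eq_iff)
  then show ?thesis using nested_idempotents_axioms by blast
qed

section \<open>The manifold structure on an orbit\<close>

locale flag_charts = continuous_inverse_algebra cscale + nested_idempotents Q n
  for cscale :: "complex \<Rightarrow> 'a \<Rightarrow>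
    'a::{ring, monoid_mult, t2_space, topological_ab_group_add, topological_monoid_mult}"
    and Q :: "nat \<Rightarrow> 'a" and n :: nat
begin

section \<open>The orbit map and its fibres\<close>

definition base_flag :: "(nat \<Rightarrow> 'a) set" where
  "base_flag = flag_class n (restrict Q {1..n})"

definition orb :: "'a \<Rightarrow> (nat \<Rightarrow> 'a) set" where
  "orb g = flag_act n g base_flag"

lemma base_flag: "base_flag \<in> flags n"
  unfolding base_flag_def by (rule flag_class_in_flags[OF restrict_idem_chain])

lemma orb_eq_flag_class:
  assumes "g \<in> unit_group"
  shows "orb g = flag_class n (\<lambda>j\<in>{1..n}. g * Q j * unit_inv g)"
    and conj_Q_idem_chain: "(\<lambda>j\<in>{1..n}. g * Q j * unit_inv g) \<in> idem_chains n"
proof -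
  have eq: "(\<lambda>j\<in>{1..n}. g * restrict Q {1..n} j * unit_inv g) = (\<lambda>j\<in>{1..n}. g * Q j * unit_inv g)"
    by (rule restrict_ext) simp
  show "orb g = flag_class n (\<lambda>j\<in>{1..n}. g * Q j * unit_inv g)"
    unfolding orb_def base_flag_def flag_act_flag_class[OF assms restrict_idem_chain] eq ..
  show "(\<lambda>j\<in>{1..n}. g * Q j * unit_inv g) \<in> idem_chains n"
    using conj_idem_chain[OF assms restrict_idem_chain] unfolding eq .
qed

text \<open>Multiplying by \<open>unit_inv a\<close> on the left and \<open>b\<close> on the right
  clears the conjugations. The fibres of \<open>orb\<close> are thus the left cosets of the
  stabilizer.\<close>

lemma orb_eq_iff:
  assumes a: "a \<in> unit_group" and b: "b \<in> unit_group"
  shows "orb a = orb b \<longleftrightarrow> unit_inv a * b \<in> stabilizer"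
proof -
  have *: "a * Q j * unit_inv a * (b * Q j * unit_inv b) = b * Q j * unit_inv b \<longleftrightarrow>
      Q j * (unit_inv a * b * Q j) = unit_inv a * b * Q j"
    if "a \<in> unit_group" "b \<in> unit_group" for a b j
  proof
    assume "a * Q j * unit_inv a * (b * Q j * unit_inv b) = b * Q j * unit_inv b"
    then have "unit_inv a * (a * Q j * unit_inv a * (b * Q j * unit_inv b)) * b
        = unit_inv a * (b * Q j * unit_inv b) * b" by simp
    then show "Q j * (unit_inv a * b * Q j) = unit_inv a * b * Q j"
      using that by (simp add: mult.assoc unit_inv unit_inv_cancel)
  next
    assume "Q j * (unit_inv a * b * Q j) = unit_inv a * b * Q j"
    then have "a * (Q j * (unit_inv a * b * Q j)) * unit_inv b = a * (unit_inv a * b * Q j) * unit_inv b"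
      by simp
    then show "a * Q j * unit_inv a * (b * Q j * unit_inv b) = b * Q j * unit_inv b"
      using that by (simp add: mult.assoc unit_inv_cancel)
  qed
  have "orb a = orb b \<longleftrightarrow> (\<forall>j\<in>{1..n}. Q j * (unit_inv a * b * Q j) = unit_inv a * b * Q j \<and>
      Q j * (unit_inv b * a * Q j) = unit_inv b * a * Q j)"
    using a b
    by (simp add: orb_eq_flag_class flag_class_eq_iff conj_Q_idem_chain idem_sim_def *
        del: One_nat_def)
  \<comment> \<open>At the remaining indices \<open>Q j\<close> is \<open>0\<close> or
    \<open>1\<close>, where both equations hold trivially.\<close>
  also have "\<dots> \<longleftrightarrow> (\<forall>j. Q j * (unit_inv a * b * Q j) = unit_inv a * b * Q j \<and>
      Q j * (unit_inv b * a * Q j) = unit_inv b * a * Q j)"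
  proof (intro iffI allI)
    fix j
    assume "\<forall>j\<in>{1..n}. Q j * (unit_inv a * b * Q j) = unit_inv a * b * Q j \<and>
      Q j * (unit_inv b * a * Q j) = unit_inv b * a * Q j"
    then show "Q j * (unit_inv a * b * Q j) = unit_inv a * b * Q j \<and>
      Q j * (unit_inv b * a * Q j) = unit_inv b * a * Q j"
      by (cases "j = 0"; cases "n < j") (simp_all add: Q_0 Q_top)
  qed simp
  also have "\<dots> \<longleftrightarrow> unit_inv a * b \<in> stabilizer"
    using a b by (simp add: stabilizer_def unit_group_mult unit_group_inv unit_inv_mult unit_inv_inv)
  finally show ?thesis .
qed

section \<open>Topology and smoothness of the unipotent factor\<close>

lemma real_subspace_lower: "real_subspace lower"
  by (simp add: real_subspace_def lower_def distrib_left distrib_right scale_mult_left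
      scale_mult_right)

lemma closed_lower: "closed lower"
proof -
  have "lower = (\<Inter>j. {x. Q (Suc j) * (x * Q j) = Q (Suc j) * x})"
    by (auto simp: lower_def)
  moreover have "closed {x. Q (Suc j) * (x * Q j) = Q (Suc j) * x}" for j
    by (intro closed_Collect_eq continuous_intros)
  ultimately show ?thesis by (simp only:) (rule closed_INT, blast)
qed

lemma continuous_on_minor: "continuous_on S (minor j)"
  unfolding minor_def by (intro continuous_intros)

lemma open_big_cell: "open big_cell"
proof -
  have "big_cell = (\<Inter>j\<in>{..Suc n}. minor j -` unit_group)"
    by (auto simp: big_cell_def)
  moreover have "open (minor j -` unit_group)" for j
    by (rule open_vimage[OF open_unit_group continuous_on_minor])
  ultimately show ?thesis by (simp only:) (rule open_INT; blast)
qed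

lemma continuous_on_unipotent: "continuous_on big_cell unipotent"
  unfolding unipotent_def projector_def
  by (intro continuous_intros continuous_on_compose2[OF continuous_unit_inv continuous_on_minor])
    (auto simp: big_cell_minor)

text \<open>The inverses in the formula are those of the minors, which are units on the big
  cell.\<close>

lemma rational_on_unipotent:
  assumes k: "rational_on G U k" and cell: "\<And>x. x \<in> U \<Longrightarrow> k x \<in> big_cell"
  shows "rational_on G U (\<lambda>x. unipotent (k x))"
proof -
  have "rational_on G U (\<lambda>x. minor j (k x))" for j
    unfolding minor_def by (intro rational_on_add rational_on_mult rational_on_const k)
  then have "rational_on G U (\<lambda>x. unit_inv (minor j (k x)))" for j
    by (rule rational_on_unit_inv) (simp add: cell big_cell_minor)
  then show ?thesis
    unfolding unipotent_def projector_def
    by (intro rational_on_sum rational_on_mult rational_on_const k)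
qed

text \<open>The common form of all maps in charts: chart changes, the orbit map and the action
  become \<open>unipotent (k x) - 1\<close> with \<open>k\<close> polynomial.\<close>

lemma smooth_on_unipotent:
  assumes "lines_continuous G" "openin (vtop G) U" "rational_on G U k"
    and cell: "\<And>x. x \<in> U \<Longrightarrow> k x \<in> big_cell" and "\<And>x. x \<in> U \<Longrightarrow> f x = unipotent (k x) - 1"
  shows "smooth_on G (subspace_lcs cscale lower) U f"
  using assms real_subspace_lower closed_lower unipotent_minus_one_lower
  by (intro smooth_on_rational[where f' = "\<lambda>x. unipotent (k x) - 1"] rational_on_diff_const
      rational_on_unipotent) auto

section \<open>The quotient topology on the orbit\<close>

abbreviation orbit_topology :: "(nat \<Rightarrow> 'a) set topology" where
  "orbit_topology \<equiv> image_topology (top_of_set unit_group) orb"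

lemma topspace_orbit_topology: "topspace orbit_topology = flag_orbit n base_flag"
  by (simp add: topspace_image_topology flag_orbit_def orb_def)

lemma continuous_map_orb: "continuous_map (top_of_set unit_group) orbit_topology orb"
  by (rule quotient_imp_continuous_map[OF quotient_map_image_topology])

text \<open>The saturation of an open \<open>V\<close> is the union of its preimages under right
  translations by the stabilizer, each of them open.\<close>

lemma open_map_orb: "open_map (top_of_set unit_group) orbit_topology orb"
  unfolding open_map_def openin_image_topology
proof (intro allI impI conjI)
  fix V :: "'a set" assume "openin (top_of_set unit_group) V"
  then have V: "open V" "V \<subseteq> unit_group"
    by (simp_all add: openin_open_eq open_unit_group)
  then show "orb ` V \<subseteq> orb ` topspace (top_of_set unit_group)" by auto
  have "{g \<in> unit_group. orb g \<in> orb ` V} = (\<Union>b\<in>stabilizer. unit_group \<inter> (\<lambda>g. g * b) -` V)"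
  proof (intro equalityI subsetI)
    fix g assume "g \<in> {g \<in> unit_group. orb g \<in> orb ` V}"
    then obtain v where g: "g \<in> unit_group" and v: "v \<in> V" "orb g = orb v" by auto
    then have "unit_inv g * v \<in> stabilizer" using orb_eq_iff V by blast
    then show "g \<in> (\<Union>b\<in>stabilizer. unit_group \<inter> (\<lambda>g. g * b) -` V)"
      using g v by (intro UN_I[of "unit_inv g * v"]) (auto simp: unit_inv_cancel)
  next
    fix g assume "g \<in> (\<Union>b\<in>stabilizer. unit_group \<inter> (\<lambda>g. g * b) -` V)"
    then obtain b where b: "b \<in> stabilizer" "g \<in> unit_group" "g * b \<in> V" by auto
    then have "orb g = orb (g * b)"
      using V by (subst orb_eq_iff) (auto simp: unit_inv_cancel)
    with b show "g \<in> {g \<in> unit_group. orb g \<in> orb ` V}" by auto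
  qed
  moreover have "open (unit_group \<inter> (\<lambda>g. g * b) -` V)" for b
    by (intro open_Int open_unit_group open_vimage V continuous_intros)
  ultimately have "open {g \<in> unit_group. orb g \<in> orb ` V}"
    by (simp only:) (rule open_UN, blast)
  then show "openin (top_of_set unit_group)
      {g \<in> topspace (top_of_set unit_group). orb g \<in> orb ` V}"
    by (simp add: openin_open_eq open_unit_group)
qed

lemma continuous_on_quotient:
  "continuous_on (unit_group \<times> unit_group) (\<lambda>z. unit_inv (fst z) * (snd z :: 'a))"
  by (intro continuous_intros continuous_on_compose2[OF continuous_unit_inv]) auto

text \<open>Distinct fibres are detected by a continuous function \<open>k\<close> with
  \<open>k (a, b) \<noteq> 0\<close>. A product neighbourhood on which \<open>k\<close> does not
  vanish has disjoint images, and these are open.\<close>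

lemma Hausdorff_orbit_topology: "Hausdorff_space orbit_topology"
proof -
  have separate: "\<exists>A B. openin orbit_topology A \<and> openin orbit_topology B \<and>
      orb a \<in> A \<and> orb b \<in> B \<and> disjnt A B"
    if a: "a \<in> unit_group" and b: "b \<in> unit_group"
      and neq: "Q j * (unit_inv a * b * Q j) \<noteq> unit_inv a * b * Q j" for a b j
  proof -
    define k where "k = (\<lambda>(a, b). Q j * (unit_inv a * b * Q j) - unit_inv a * b * Q j)"
    have "continuous_on (unit_group \<times> unit_group) k"
      unfolding k_def case_prod_unfold
      by (intro continuous_on_diff continuous_on_quotient continuous_on_mult' continuous_on_const)
    then have "open (k -` (- {0}) \<inter> unit_group \<times> unit_group)"
      using continuous_on_open_vimage[OF open_Times[OF open_unit_group open_unit_group]] by blast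
    then obtain A B where AB: "open A" "open B" "(a, b) \<in> A \<times> B"
        "A \<times> B \<subseteq> k -` (- {0}) \<inter> unit_group \<times> unit_group"
      using a b neq by (elim open_prod_elim[of _ "(a, b)"]) (auto simp: k_def)
    have sub: "A \<subseteq> unit_group" "B \<subseteq> unit_group" using AB by auto
    have "disjnt (orb ` A) (orb ` B)"
      unfolding disjnt_iff
    proof (intro allI notI, elim conjE imageE)
      fix Y x y assume xy: "x \<in> A" "y \<in> B" "Y = orb x" "Y = orb y"
      then have "unit_inv x * y \<in> stabilizer" using orb_eq_iff[of x y] sub by auto
      then have "k (x, y) = 0" by (simp add: k_def stabilizer_def)
      then show False using AB(4) xy by auto
    qed
    moreover have "openin orbit_topology (orb ` A)" "openin orbit_topology (orb ` B)"
      using AB sub open_map_orb by (simp_all add: open_map_def openin_open_eq open_unit_group)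
    ultimately show ?thesis using AB(3) by blast
  qed
  show ?thesis
    unfolding Hausdorff_space_def topspace_image_topology topspace_euclidean_subtopology
  proof (intro allI impI, elim conjE imageE)
    fix Y Z a b assume ne: "Y \<noteq> Z" and a: "Y = orb a" "a \<in> unit_group" and b: "Z = orb b" "b \<in> unit_group"
    then have "unit_inv a * b \<notin> stabilizer" using orb_eq_iff by metis
    \<comment> \<open>Either \<open>unit_inv a * b\<close> or its inverse fails to preserve some
      \<open>Q j\<close>; the second case exchanges the two points.\<close>
    then obtain j where "Q j * (unit_inv a * b * Q j) \<noteq> unit_inv a * b * Q j \<or>
        Q j * (unit_inv b * a * Q j) \<noteq> unit_inv b * a * Q j"
      using a b by (auto simp: stabilizer_def unit_group_mult unit_group_inv unit_inv_mult unit_inv_inv)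
    then show "\<exists>U V. openin orbit_topology U \<and> openin orbit_topology V \<and> Y \<in> U \<and> Z \<in> V \<and> disjnt U V"
      using separate[OF a(2) b(2), of j] separate[OF b(2) a(2), of j] a(1) b(1) by (metis disjnt_sym)
  qed
qed

section \<open>Cells and charts\<close>

definition cell_units :: "'a \<Rightarrow> 'a set" where
  "cell_units g = {a \<in> unit_group. unit_inv g * a \<in> big_cell}"

definition cell :: "'a \<Rightarrow> (nat \<Rightarrow> 'a) set set" where
  "cell g = orb ` cell_units g"

text \<open>For a unit \<open>g\<close> the choice is harmless on \<open>cell g\<close>: by
  \<open>unipotent_saturated\<close> all representatives give the same value.\<close>

definition chart :: "'a \<Rightarrow> (nat \<Rightarrow> 'a) set \<Rightarrow> 'a" where
  "chart g Y = unipotent (unit_inv g * (SOME a. a \<in> unit_group \<and> orb a = Y)) - 1"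

definition point :: "'a \<Rightarrow> 'a \<Rightarrow> (nat \<Rightarrow> 'a) set" where
  "point g x = orb (g * (1 + x))"

lemma open_cell_units: "open (cell_units g)"
proof -
  have "cell_units g = unit_group \<inter> (\<lambda>a. unit_inv g * a) -` big_cell"
    by (auto simp: cell_units_def)
  then show ?thesis
    by (simp add: open_Int open_unit_group open_vimage open_big_cell continuous_intros)
qed

lemma openin_cell: "openin orbit_topology (cell g)"
proof -
  have "openin (top_of_set unit_group) (cell_units g)"
    using open_cell_units by (auto simp: openin_open_eq open_unit_group cell_units_def)
  then show ?thesis using open_map_orb by (simp add: cell_def open_map_def)
qed

text \<open>Two representatives differ on the right by a stabilizer element, which changes neither
  membership in the big cell nor the unipotent factor.\<close>

lemma
  assumes g: "g \<in> unit_group" and a: "a \<in> unit_group" and b: "b \<in> cell_units g" and eq: "orb a = orb b"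
  shows cell_units_saturated: "a \<in> cell_units g"
    and unipotent_saturated: "unipotent (unit_inv g * a) = unipotent (unit_inv g * b)"
proof -
  have bU: "b \<in> unit_group" and bO: "unit_inv g * b \<in> big_cell" using b by (auto simp: cell_units_def)
  have s: "unit_inv b * a \<in> stabilizer" using orb_eq_iff[OF bU a] eq by simp
  have "unit_inv g * a = unit_inv g * b * (unit_inv b * a)"
    by (simp add: mult.assoc unit_inv_cancel[OF bU])
  with big_cell_mult_stabilizer[OF bO s] unipotent_mult_stabilizer[OF bO s] a
  show "a \<in> cell_units g" "unipotent (unit_inv g * a) = unipotent (unit_inv g * b)"
    by (simp_all add: cell_units_def)
qed

lemma orb_in_cell_iff:
  assumes "g \<in> unit_group" "a \<in> unit_group"
  shows "orb a \<in> cell g \<longleftrightarrow> a \<in> cell_units g"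
  using cell_units_saturated[OF assms] by (auto simp: cell_def)

lemma chart_orb:
  assumes g: "g \<in> unit_group" and a: "a \<in> cell_units g"
  shows "chart g (orb a) = unipotent (unit_inv g * a) - 1"
proof -
  let ?b = "SOME b. b \<in> unit_group \<and> orb b = orb a"
  have "?b \<in> unit_group \<and> orb ?b = orb a"
    by (rule someI[of _ a]) (use a in \<open>simp add: cell_units_def\<close>)
  then show ?thesis
    unfolding chart_def using unipotent_saturated[OF g _ a, of ?b] by simp
qed

lemma shift_lower_cell_units:
  assumes "g \<in> unit_group" "x \<in> lower"
  shows "g * (1 + x) \<in> cell_units g"
  using assms by (simp add: cell_units_def unit_group_mult one_plus_lower_unit unit_inv_cancel
      one_plus_lower_in_big_cell)

lemma
  assumes "g \<in> unit_group" "x \<in> lower"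
  shows point_in_cell: "point g x \<in> cell g"
    and chart_point: "chart g (point g x) = x"
  using shift_lower_cell_units[OF assms] assms
  by (auto simp: point_def cell_def chart_orb unit_inv_cancel unipotent_one_plus_lower)

text \<open>By the factorization, \<open>a\<close> and \<open>g * u\<close> give the same point of
  the orbit when \<open>u\<close> is the unipotent factor of \<open>unit_inv g * a\<close>.\<close>

lemma
  assumes g: "g \<in> unit_group" and Y: "Y \<in> cell g"
  shows chart_in_lower: "chart g Y \<in> lower"
    and point_chart: "point g (chart g Y) = Y"
proof -
  obtain a where a: "a \<in> cell_units g" "Y = orb a" using Y by (auto simp: cell_def)
  then have aU: "a \<in> unit_group" and aO: "unit_inv g * a \<in> big_cell" by (auto simp: cell_units_def)
  let ?u = "unipotent (unit_inv g * a)"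
  have chart: "chart g Y = ?u - 1" by (simp add: a chart_orb[OF g])
  show lower: "chart g Y \<in> lower" unfolding chart by (rule unipotent_minus_one_lower[OF aO])
  have u: "?u \<in> unit_group" using one_plus_lower_unit[OF lower] by (simp add: chart)
  have "unit_inv a * (g * ?u) \<in> stabilizer"
    using unipotent_stabilizer[OF aO] g aU
    by (simp add: unit_inv_mult unit_group_inv unit_inv_inv mult.assoc)
  then have "orb a = orb (g * ?u)" using orb_eq_iff aU unit_group_mult[OF g u] by blast
  moreover have "point g (chart g Y) = orb (g * ?u)" by (simp add: point_def chart)
  ultimately show "point g (chart g Y) = Y" by (simp only: a(2))
qed

lemma chart_image_cell: "g \<in> unit_group \<Longrightarrow> chart g ` cell g = lower"
  using chart_in_lower chart_point point_in_cell by (force simp: image_iff)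

lemma inj_on_chart: "g \<in> unit_group \<Longrightarrow> inj_on (chart g) (cell g)"
  by (metis inj_on_inverseI point_chart)

lemma inv_into_chart: "g \<in> unit_group \<Longrightarrow> x \<in> lower \<Longrightarrow> inv_into (cell g) (chart g) x = point g x"
  by (intro inv_into_f_eq inj_on_chart point_in_cell chart_point)

text \<open>Over the open cell the orbit map restricts to a quotient map, so continuity of
  \<open>chart g \<circ> orb\<close> suffices.\<close>

lemma continuous_map_chart:
  assumes g: "g \<in> unit_group"
  shows "continuous_map (subtopology orbit_topology (cell g)) (top_of_set lower) (chart g)"
proof -
  have "quotient_map (subtopology (top_of_set unit_group) (cell_units g))
      (subtopology orbit_topology (cell g)) orb"
    by (rule quotient_map_restriction[OF quotient_map_image_topology])
      (auto simp: orb_in_cell_iff[OF g] openin_cell cell_units_def)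
  moreover have "subtopology (top_of_set unit_group) (cell_units g) = top_of_set (cell_units g)"
    by (auto simp: subtopology_subtopology cell_units_def intro!: arg_cong2[where f = subtopology])
  moreover have "continuous_map (top_of_set (cell_units g)) (top_of_set lower) (chart g \<circ> orb)"
  proof (rule continuous_map_eq)
    have "continuous_on (cell_units g) (\<lambda>a. unipotent (unit_inv g * a) - 1)"
      by (intro continuous_intros continuous_on_compose2[OF continuous_on_unipotent])
        (auto simp: cell_units_def)
    then show "continuous_map (top_of_set (cell_units g)) (top_of_set lower)
        (\<lambda>a. unipotent (unit_inv g * a) - 1)"
      by (auto simp: continuous_map_in_subtopology cell_units_def intro: unipotent_minus_one_lower)
  qed (simp add: chart_orb[OF g])
  ultimately show ?thesis
    by (metis continuous_compose_quotient_map)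
qed

lemma continuous_map_point:
  assumes g: "g \<in> unit_group"
  shows "continuous_map (top_of_set lower) (subtopology orbit_topology (cell g)) (point g)"
proof -
  have "continuous_on lower (\<lambda>x. g * (1 + x))" by (intro continuous_intros)
  then have "continuous_map (top_of_set lower) (top_of_set unit_group) (\<lambda>x. g * (1 + x))"
    using g by (auto simp: continuous_map_in_subtopology intro: unit_group_mult one_plus_lower_unit)
  from continuous_map_compose[OF this continuous_map_orb]
  show ?thesis
    using point_in_cell[OF g] by (auto simp: continuous_map_in_subtopology o_def point_def[abs_def])
qed

section \<open>The atlas, the orbit map and the action\<close>

definition flag_manifold :: "((nat \<Rightarrow> 'a) set, 'a) manifold" where
  "flag_manifold = \<lparr>model = subspace_lcs cscale lower, mtop = orbit_topology,
    charts = (\<lambda>g. (cell g, chart g)) ` unit_group\<rparr>"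

lemma flag_manifold_simps [simp]:
  "model flag_manifold = subspace_lcs cscale lower"
  "mtop flag_manifold = orbit_topology"
  "charts flag_manifold = (\<lambda>g. (cell g, chart g)) ` unit_group"
  by (simp_all add: flag_manifold_def)

lemma unit_manifold_simps [simp]:
  "model (unit_manifold cscale) = subspace_lcs cscale UNIV"
  "mtop (unit_manifold cscale) = top_of_set unit_group"
  "charts (unit_manifold cscale) = {(unit_group, \<lambda>x. x)}"
  by (simp_all add: unit_manifold_def subspace_lcs_UNIV)

lemma one_in_big_cell: "1 \<in> big_cell"
  by (simp add: big_cell_def minor_one unit_group_one)

lemma orb_in_own_cell: "g \<in> unit_group \<Longrightarrow> orb g \<in> cell g"
  by (simp add: orb_in_cell_iff cell_units_def unit_inv one_in_big_cell)

lemma chart_image_overlap: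
  assumes g: "g \<in> unit_group"
  shows "chart g ` (cell g \<inter> A) = {x \<in> lower. point g x \<in> A}"
proof (intro equalityI subsetI)
  fix x assume "x \<in> chart g ` (cell g \<inter> A)"
  then show "x \<in> {x \<in> lower. point g x \<in> A}"
    using chart_in_lower[OF g] point_chart[OF g] by auto
next
  fix x assume "x \<in> {x \<in> lower. point g x \<in> A}"
  then show "x \<in> chart g ` (cell g \<inter> A)"
    using chart_point[OF g, of x] point_in_cell[OF g, of x] by (intro image_eqI[of _ _ "point g x"]) auto
qed

text \<open>With \<open>a = 1\<close> this describes the domains of chart changes, for general
  \<open>a\<close> those of the action in charts.\<close>

lemma act_point_in_cell_iff:
  assumes "g \<in> unit_group" "h \<in> unit_group" "a \<in> unit_group" "x \<in> lower"
  shows "orb (a * (g * (1 + x))) \<in> cell h \<longleftrightarrow> unit_inv h * (a * (g * (1 + x))) \<in> big_cell"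
  using assms by (simp add: orb_in_cell_iff unit_group_mult one_plus_lower_unit cell_units_def)

lemma smooth_manifold_flag_manifold: "smooth_manifold flag_manifold"
proof (rule smooth_manifold.intro)
  show "locally_convex_space (model flag_manifold)"
    by (simp add: locally_convex_space_subspace real_subspace_lower)
  show "Hausdorff_space (mtop flag_manifold)"
    by (simp add: Hausdorff_orbit_topology)
  show "(\<Union>(U, \<phi>)\<in>charts flag_manifold. U) = topspace (mtop flag_manifold)"
    using orb_in_own_cell openin_subset[OF openin_cell]
    by (auto simp: topspace_image_topology)
next
  fix U \<phi> assume "(U, \<phi>) \<in> charts flag_manifold"
  then obtain g where g: "g \<in> unit_group" "U = cell g" "\<phi> = chart g" by auto
  then show "openin (mtop flag_manifold) U \<and> openin (vtop (model flag_manifold)) (\<phi> ` U)"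
    by (simp add: openin_cell chart_image_cell)
  have "homeomorphic_maps (subtopology orbit_topology (cell g)) (top_of_set lower) (chart g) (point g)"
    using g(1) by (simp add: homeomorphic_maps_def continuous_map_chart continuous_map_point
        point_chart chart_point)
  then show "homeomorphic_map (subtopology (mtop flag_manifold) U)
      (subtopology (vtop (model flag_manifold)) (\<phi> ` U)) \<phi>"
    using g by (auto simp: chart_image_cell subtopology_subtopology homeomorphic_map_maps)
next
  fix U V \<phi> \<psi> assume "(U, \<phi>) \<in> charts flag_manifold" "(V, \<psi>) \<in> charts flag_manifold"
  then obtain g h where g: "g \<in> unit_group" "U = cell g" "\<phi> = chart g"
    and h: "h \<in> unit_group" "V = cell h" "\<psi> = chart h" by auto
  \<comment> \<open>\<open>point g x\<close> is represented by \<open>g * (1 + x)\<close>, so the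
    chart change sends \<open>x\<close> to \<open>unipotent (?k x) - 1\<close>.\<close>
  let ?k = "\<lambda>x. unit_inv h * (g * (1 + x))"
  have dom: "\<phi> ` (U \<inter> V) = {x \<in> lower. ?k x \<in> big_cell}"
    using act_point_in_cell_iff[OF g(1) h(1) unit_group_one]
    by (auto simp: g(2,3) h(2) chart_image_overlap[OF g(1)] point_def)
  show "smooth_on (model flag_manifold) (model flag_manifold) (\<phi> ` (U \<inter> V)) (\<psi> \<circ> inv_into U \<phi>)"
    unfolding flag_manifold_simps dom
  proof (rule smooth_on_unipotent[where k = ?k])
    show "lines_continuous (subspace_lcs cscale lower)"
      by (rule lines_continuous_subspace[OF real_subspace_lower])
    have "open (?k -` big_cell)" by (intro open_vimage open_big_cell continuous_intros)
    moreover have "{x \<in> lower. ?k x \<in> big_cell} = lower \<inter> ?k -` big_cell" by auto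
    ultimately show "openin (vtop (subspace_lcs cscale lower)) {x \<in> lower. ?k x \<in> big_cell}"
      by (simp add: openin_open_Int)
    show "rational_on (subspace_lcs cscale lower) {x \<in> lower. ?k x \<in> big_cell} ?k"
      by (intro rational_on_mult rational_on_add rational_on_const rational_on_linear linear_subspace_incl)
    show "(\<psi> \<circ> inv_into U \<phi>) x = unipotent (?k x) - 1" if "x \<in> {x \<in> lower. ?k x \<in> big_cell}" for x
      using that g h by (simp add: inv_into_chart point_def chart_orb cell_units_def unit_group_mult
          one_plus_lower_unit)
  qed simp
qed

lemma smooth_map_orb: "smooth_map (unit_manifold cscale) flag_manifold orb"
  unfolding smooth_map_def
proof (intro conjI ballI)
  show "continuous_map (mtop (unit_manifold cscale)) (mtop flag_manifold) orb"
    by (simp add: continuous_map_orb)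
  show "case c of (U, \<phi>) \<Rightarrow> \<forall>(V, \<psi>)\<in>charts flag_manifold.
      smooth_on (model (unit_manifold cscale)) (model flag_manifold)
        (\<phi> ` {x \<in> U. orb x \<in> V}) (\<psi> \<circ> orb \<circ> inv_into U \<phi>)"
    if "c \<in> charts (unit_manifold cscale)" for c
  proof -
    have "smooth_on (subspace_lcs cscale UNIV) (subspace_lcs cscale lower)
        ((\<lambda>x. x) ` {x \<in> unit_group. orb x \<in> cell h}) (chart h \<circ> orb \<circ> inv_into unit_group (\<lambda>x. x))"
      if h: "h \<in> unit_group" for h
    proof -
      have dom: "(\<lambda>x. x) ` {x \<in> unit_group. orb x \<in> cell h} = cell_units h"
        by (auto simp: orb_in_cell_iff[OF h] cell_units_def)
      show ?thesis
        unfolding dom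
      proof (rule smooth_on_unipotent[where k = "\<lambda>x. unit_inv h * x"])
        show "lines_continuous (subspace_lcs cscale UNIV)"
          by (rule lines_continuous_subspace[OF real_subspace_UNIV])
        show "openin (vtop (subspace_lcs cscale UNIV)) (cell_units h)"
          by (simp add: open_cell_units)
        show "rational_on (subspace_lcs cscale UNIV) (cell_units h) (\<lambda>x. unit_inv h * x)"
          by (intro rational_on_mult rational_on_const rational_on_linear linear_subspace_incl)
        fix x assume x: "x \<in> cell_units h"
        then show "unit_inv h * x \<in> big_cell" by (simp add: cell_units_def)
        have "inv_into unit_group (\<lambda>x. x) x = x"
          using x by (intro inv_into_f_eq) (auto simp: cell_units_def)
        then show "(chart h \<circ> orb \<circ> inv_into unit_group (\<lambda>x. x)) x = unipotent (unit_inv h * x) - 1"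
          by (simp add: chart_orb[OF h x])
      qed
    qed
    with that show ?thesis by auto
  qed
qed

lemma flag_act_orb: "a \<in> unit_group \<Longrightarrow> g \<in> unit_group \<Longrightarrow> flag_act n a (orb g) = orb (a * g)"
  by (simp add: orb_def flag_act_mult base_flag)

text \<open>Since \<open>orb\<close> is open, its product with the identity is a quotient map.
  Continuity is therefore tested on pairs of units, where the map is multiplication followed by
  \<open>orb\<close>.\<close>

lemma continuous_map_flag_act:
  "continuous_map (prod_topology (top_of_set unit_group) orbit_topology) orbit_topology
    (\<lambda>(g, Y). flag_act n g Y)"
proof (rule continuous_compose_quotient_map)
  let ?X = "prod_topology (top_of_set unit_group) (top_of_set (unit_group :: 'a set))"
  have "continuous_map ?X (prod_topology (top_of_set unit_group) orbit_topology) (\<lambda>(x, y). (x, orb y))"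
    unfolding continuous_map_prod_top using continuous_map_orb by simp
  moreover have "(\<lambda>(x, y). (x, orb y)) ` topspace ?X =
      topspace (prod_topology (top_of_set unit_group) orbit_topology)"
    by (force simp: topspace_image_topology)
  ultimately show "quotient_map ?X (prod_topology (top_of_set unit_group) orbit_topology) (\<lambda>(x, y). (x, orb y))"
    using open_map_prod_id[OF open_map_orb] by (intro continuous_open_imp_quotient_map)
  have "continuous_on (unit_group \<times> unit_group) (\<lambda>z. fst z * snd z :: 'a)"
    by (intro continuous_intros)
  then have "continuous_map ?X (top_of_set unit_group) (\<lambda>z. fst z * snd z)"
    by (auto simp: continuous_map_in_subtopology unit_group_mult
        simp flip: subtopology_Times)
  from continuous_map_compose[OF this continuous_map_orb]
  show "continuous_map ?X orbit_topology ((\<lambda>(g, Y). flag_act n g Y) \<circ> (\<lambda>(x, y). (x, orb y)))"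
    by (rule continuous_map_eq) (auto simp: flag_act_orb)
qed

lemma smooth_map_flag_act:
  "smooth_map (prod_manifold (unit_manifold cscale) flag_manifold) flag_manifold
    (\<lambda>(g, Y). flag_act n g Y)"
proof -
  let ?act = "\<lambda>(g, Y). flag_act n g Y"
  let ?G = "prod_lcs (subspace_lcs cscale UNIV) (subspace_lcs cscale lower)"
  have smooth: "smooth_on ?G (subspace_lcs cscale lower)
      ((\<lambda>(a, Y). (a, chart g Y)) ` {z \<in> unit_group \<times> cell g. ?act z \<in> cell h})
      (chart h \<circ> ?act \<circ> inv_into (unit_group \<times> cell g) (\<lambda>(a, Y). (a, chart g Y)))"
    if g: "g \<in> unit_group" and h: "h \<in> unit_group" for g h
  proof -
    let ?\<Phi> = "\<lambda>(a, Y). (a :: 'a, chart g Y)"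
    \<comment> \<open>The action in the charts of \<open>g\<close> and \<open>h\<close> before the
      unipotent factor is taken, a polynomial in the pair \<open>z\<close>.\<close>
    let ?k = "\<lambda>z. unit_inv h * (fst z * (g * (1 + snd z)))"
    have act_point: "flag_act n a (point g x) = orb (a * (g * (1 + x)))"
      if "a \<in> unit_group" "x \<in> lower" for a x
      using that g by (simp add: point_def flag_act_orb unit_group_mult one_plus_lower_unit)
    have dom: "?\<Phi> ` {z \<in> unit_group \<times> cell g. ?act z \<in> cell h} =
        (UNIV \<times> lower) \<inter> ((unit_group \<times> UNIV) \<inter> ?k -` big_cell)"
    proof (intro equalityI subsetI)
      fix w assume "w \<in> ?\<Phi> ` {z \<in> unit_group \<times> cell g. ?act z \<in> cell h}"
      then obtain a Y where aY: "a \<in> unit_group" "Y \<in> cell g" "flag_act n a Y \<in> cell h" "w = (a, chart g Y)"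
        by auto
      with act_point[OF aY(1) chart_in_lower[OF g aY(2)]]
        act_point_in_cell_iff[OF g h aY(1) chart_in_lower[OF g aY(2)]]
      show "w \<in> (UNIV \<times> lower) \<inter> ((unit_group \<times> UNIV) \<inter> ?k -` big_cell)"
        by (simp add: point_chart[OF g] chart_in_lower[OF g])
    next
      fix w assume "w \<in> (UNIV \<times> lower) \<inter> ((unit_group \<times> UNIV) \<inter> ?k -` big_cell)"
      then obtain a x where ax: "w = (a, x)" "a \<in> unit_group" "x \<in> lower" "?k (a, x) \<in> big_cell"
        by (cases w) auto
      then show "w \<in> ?\<Phi> ` {z \<in> unit_group \<times> cell g. ?act z \<in> cell h}"
        using act_point_in_cell_iff[OF g h ax(2,3)]
        by (intro image_eqI[of _ _ "(a, point g x)"])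
          (simp_all add: chart_point[OF g] point_in_cell[OF g] act_point)
    qed
    show ?thesis
      unfolding dom
    proof (rule smooth_on_unipotent[where k = ?k])
      show "lines_continuous ?G"
        by (intro lines_continuous_prod lines_continuous_subspace real_subspace_UNIV real_subspace_lower)
      have "open ((unit_group \<times> UNIV) \<inter> ?k -` big_cell)"
        by (intro open_Int open_Times open_unit_group open_UNIV open_vimage open_big_cell continuous_intros)
      moreover have "vtop ?G = top_of_set (UNIV \<times> lower)"
        unfolding prod_lcs_simps subspace_lcs_simps
        by (simp only: prod_topology_euclidean[symmetric] subtopology_Times)
      ultimately show "openin (vtop ?G)
          ((UNIV \<times> lower) \<inter> ((unit_group \<times> UNIV) \<inter> ?k -` big_cell))"
        by (simp only: openin_open_Int)
      show "rational_on ?G ((UNIV \<times> lower) \<inter> ((unit_group \<times> UNIV) \<inter> ?k -` big_cell)) ?k"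
        by (intro rational_on_mult rational_on_add rational_on_const rational_on_linear
            linear_to_algebra_prod(1)[of _ "\<lambda>x. x"] linear_to_algebra_prod(2)[of _ "\<lambda>x. x"]
            linear_subspace_incl)
      fix w assume "w \<in> (UNIV \<times> lower) \<inter> ((unit_group \<times> UNIV) \<inter> ?k -` big_cell)"
      then obtain a x where ax: "w = (a, x)" "a \<in> unit_group" "x \<in> lower" "?k (a, x) \<in> big_cell"
        by (cases w) auto
      then show "?k w \<in> big_cell" by simp
      have "inj_on ?\<Phi> (unit_group \<times> cell g)"
        using inj_on_chart[OF g] by (auto simp: inj_on_def)
      then have "inv_into (unit_group \<times> cell g) ?\<Phi> w = (a, point g x)"
        using ax by (intro inv_into_f_eq) (auto simp: point_in_cell[OF g] chart_point[OF g])
      moreover have "a * (g * (1 + x)) \<in> cell_units h"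
        using ax g by (simp add: cell_units_def unit_group_mult one_plus_lower_unit)
      ultimately show "(chart h \<circ> ?act \<circ> inv_into (unit_group \<times> cell g) ?\<Phi>) w = unipotent (?k w) - 1"
        using ax by (simp add: act_point chart_orb[OF h])
    qed
  qed
  have charts: "smooth_on ?G (subspace_lcs cscale lower) (\<Phi> ` {z \<in> U. ?act z \<in> V})
      (\<psi> \<circ> ?act \<circ> inv_into U \<Phi>)"
    if U: "(U, \<Phi>) \<in> charts (prod_manifold (unit_manifold cscale) flag_manifold)"
      and V: "(V, \<psi>) \<in> charts flag_manifold" for U \<Phi> V \<psi>
  proof -
    obtain g where g: "g \<in> unit_group" "U = unit_group \<times> cell g" "\<Phi> = (\<lambda>(a, Y). (a, chart g Y))"
      using U by (auto simp: prod_manifold_def)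
    obtain h where h: "h \<in> unit_group" "V = cell h" "\<psi> = chart h"
      using V by auto
    show ?thesis unfolding g(2,3) h(2,3) by (rule smooth[OF g(1) h(1)])
  qed
  have models: "model (prod_manifold (unit_manifold cscale) flag_manifold) = ?G"
    "mtop (prod_manifold (unit_manifold cscale) flag_manifold) =
      prod_topology (top_of_set unit_group) orbit_topology"
    by (simp_all add: prod_manifold_def)
  show ?thesis
    unfolding smooth_map_def flag_manifold_simps(1,2) models
    by (intro conjI ballI case_prodI2 continuous_map_flag_act) (hypsubst, rule charts)
qed

lemma flag_manifold_structure_flag_manifold:
  "flag_manifold_structure cscale n base_flag flag_manifold"
proof -
  have "(\<lambda>g. flag_act n g base_flag) = orb" by (simp add: orb_def fun_eq_iff)
  then show ?thesis
    using smooth_manifold_flag_manifold smooth_map_flag_act smooth_map_orb open_map_orb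
    by (simp add: flag_manifold_structure_def topspace_orbit_topology)
qed

end

section \<open>Continuity of the map to the Grassmannians\<close>

lemma continuous_map_flag_to_gr:
  fixes cscale :: "complex \<Rightarrow> 'a \<Rightarrow>
      'a::{ring, monoid_mult, t2_space, topological_ab_group_add, topological_monoid_mult}"
    and M :: "(nat \<Rightarrow> 'a) set set \<Rightarrow> ((nat \<Rightarrow> 'a) set, 'e) manifold"
  assumes "continuous_inverse_algebra cscale"
    and M: "\<forall>Y\<in>flag_orbits n. \<exists>X\<in>Y. flag_manifold_structure cscale n X (M Y)"
  shows "continuous_map (flag_topology n (\<lambda>Y. mtop (M Y)))
    (product_topology (\<lambda>_. gr_topology) {1..n}) (flag_to_gr n)"
proof -
  interpret continuous_inverse_algebra cscale by fact
  let ?T = "flag_topology n (\<lambda>Y. mtop (M Y))"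
  \<comment> \<open>The structure on \<open>Y\<close> may be based at any flag \<open>X\<close> in
    \<open>Y\<close>. Since \<open>X\<close> generates the same orbit, a representative
    \<open>p\<close> of it describes all of \<open>Y\<close>.\<close>
  have orbit: "\<exists>p\<in>idem_chains n. Y = flag_orbit n (flag_class n p) \<and> topspace (mtop (M Y)) = Y \<and>
      open_map (top_of_set unit_group) (mtop (M Y)) (\<lambda>g. flag_act n g (flag_class n p))"
    if Y: "Y \<in> flag_orbits n" for Y
  proof -
    obtain Z where Z: "Z \<in> flags n" "Y = flag_orbit n Z" using Y by (auto simp: flag_orbits_def)
    obtain X where X: "X \<in> Y" "flag_manifold_structure cscale n X (M Y)" using M Y by blast
    have "Y = flag_orbit n X" using flag_orbit_eq[OF Z(1)] X(1) Z(2) by simp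
    moreover have "X \<in> flags n" using X(1) Z by (auto simp: flag_orbit_def flag_act_in_flags)
    then obtain p where "p \<in> idem_chains n" "X = flag_class n p" by (rule flagsE)
    ultimately show ?thesis
      using X(2) by (intro bexI[of _ p]) (simp_all add: flag_manifold_structure_def unit_manifold_def)
  qed
  have "openin ?T (flags n)"
    unfolding openin_flag_topology
  proof (intro conjI ballI)
    fix Y :: "(nat \<Rightarrow> 'a) set set" assume Y: "Y \<in> flag_orbits n"
    then have "flags n \<inter> Y = topspace (mtop (M Y))"
      using orbit[OF Y] by (auto simp: flag_orbit_def flag_act_in_flags flag_class_in_flags)
    then show "openin (mtop (M Y)) (flags n \<inter> Y)" by simp
  qed simp
  then have top: "topspace ?T = flags n"
    by (metis openin_flag_topology openin_subset openin_topspace subset_antisym)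
  have gr: "gr_class q \<in> topspace (gr_topology :: 'a set topology)" if "q \<in> idempotents" for q
    using quotient_imp_surjective_map[OF quotient_map_gr_class] that by auto
  have "continuous_map ?T gr_topology (\<lambda>X. flag_to_gr n X k)" if k: "k \<in> {1..n}" for k
    unfolding continuous_map_def top
  proof (intro conjI allI impI)
    show "(\<lambda>X. flag_to_gr n X k) \<in> flags n \<rightarrow> topspace (gr_topology :: 'a set topology)"
    proof
      fix X :: "(nat \<Rightarrow> 'a) set" assume "X \<in> flags n"
      then obtain p where p: "p \<in> idem_chains n" "X = flag_class n p" by (rule flagsE)
      then have "p k \<in> idempotents" using k by (auto simp: idem_chains_def)
      from gr[OF this] show "flag_to_gr n X k \<in> topspace gr_topology"
        using p k by (simp add: flag_to_gr_flag_class)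
    qed
    fix W :: "'a set set" assume W: "openin gr_topology W"
    show "openin ?T {X \<in> flags n. flag_to_gr n X k \<in> W}"
      unfolding openin_flag_topology
    proof (intro conjI ballI)
      fix Y :: "(nat \<Rightarrow> 'a) set set" assume Y: "Y \<in> flag_orbits n"
      then obtain p where p: "p \<in> idem_chains n" and Yp: "Y = flag_orbit n (flag_class n p)"
        and op: "open_map (top_of_set unit_group) (mtop (M Y)) (\<lambda>g. flag_act n g (flag_class n p))"
        using orbit by blast
      have act: "flag_to_gr n (flag_act n g (flag_class n p)) k = gr_class (g * p k * unit_inv g)"
        if "g \<in> unit_group" for g
        using that p k
        by (simp add: flag_act_flag_class flag_to_gr_flag_class conj_idem_chain del: One_nat_def)
      have "continuous_on unit_group (\<lambda>g. g * p k * unit_inv g)"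
        by (intro continuous_intros continuous_unit_inv)
      moreover have "g * p k * unit_inv g \<in> idempotents" if "g \<in> unit_group" for g
        using p k conj_mult_conj[OF that, of "p k" "p k"]
        by (auto simp: idem_chains_def idempotents_def PiE_iff)
      ultimately have "continuous_map (top_of_set unit_group) (top_of_set idempotents) (\<lambda>g. g * p k * unit_inv g)"
        by (auto simp: continuous_map_in_subtopology)
      from continuous_map_compose[OF this quotient_imp_continuous_map[OF quotient_map_gr_class]]
      have "continuous_map (top_of_set unit_group) gr_topology (\<lambda>g. gr_class (g * p k * unit_inv g))"
        by (simp add: o_def)
      then have "openin (top_of_set unit_group)
          {g \<in> topspace (top_of_set unit_group). gr_class (g * p k * unit_inv g) \<in> W}"
        using W by (rule openin_continuous_map_preimage)
      then have "openin (mtop (M Y)) ((\<lambda>g. flag_act n g (flag_class n p)) `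
          {g \<in> unit_group. gr_class (g * p k * unit_inv g) \<in> W})"
        using op by (simp add: open_map_def)
      \<comment> \<open>The part in \<open>Y\<close> of the preimage of \<open>W\<close> is the
        image of an open set of units under the orbit map, hence open.\<close>
      moreover have "(\<lambda>g. flag_act n g (flag_class n p)) `
          {g \<in> unit_group. gr_class (g * p k * unit_inv g) \<in> W} =
          {X \<in> flags n. flag_to_gr n X k \<in> W} \<inter> Y"
        using p by (auto simp: Yp flag_orbit_def act flag_act_in_flags flag_class_in_flags)
      ultimately show "openin (mtop (M Y)) ({X \<in> flags n. flag_to_gr n X k \<in> W} \<inter> Y)"
        by simp
    qed auto
  qed
  then show ?thesis
    by (auto simp: continuous_map_componentwise flag_to_gr_def)
qed

theorem theorem4p3:
  fixes cscale :: "complex \<Rightarrow> 'a \<Rightarrow>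
      'a::{ring, monoid_mult, t2_space, topological_ab_group_add, topological_monoid_mult}"
    and n :: nat and p :: "nat \<Rightarrow> 'a"
  assumes "continuous_inverse_algebra cscale"
    and "n \<ge> 1"
    and "p \<in> idem_chains n"
  shows "transitive_unit_action (flag_act n) (flag_orbit n (flag_class n p)) \<and>
    (\<exists>M :: ((nat \<Rightarrow> 'a) set, 'a) manifold.
      flag_manifold_structure cscale n (flag_class n p) M) \<and>
    inj_on (flag_to_gr n) (flags n :: (nat \<Rightarrow> 'a) set set) \<and>
    (\<forall>M :: (nat \<Rightarrow> 'a) set set \<Rightarrow> ((nat \<Rightarrow> 'a) set, 'a) manifold.
      (\<forall>Y\<in>flag_orbits n. \<exists>X\<in>Y. flag_manifold_structure cscale n X (M Y)) \<longrightarrow>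
      continuous_map (flag_topology n (\<lambda>Y. mtop (M Y)))
        (product_topology (\<lambda>_. gr_topology) {1..n}) (flag_to_gr n))"
proof -
  \<comment> \<open>The commuting representative gives the same flag, so results about
    \<open>base_flag\<close> are results about \<open>flag_class n p\<close>.\<close>
  obtain Q where Q: "nested_idempotents Q n"
      "flag_class n (restrict Q {1..n}) = flag_class n p"
    using nested_representative[OF assms(3)] by blast
  interpret flag_charts cscale Q n
    using assms(1) Q(1) by (rule flag_charts.intro)
  show ?thesis
    using transitive_unit_action_flag_orbit[OF flag_class_in_flags[OF assms(3)]]
      flag_manifold_structure_flag_manifold inj_on_flag_to_gr
      continuous_map_flag_to_gr[OF assms(1)]
    unfolding base_flag_def Q(2) by blast
qed

end
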